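(* Let $\mathcal{C}=(S,\mathbf{R},L)$ be a labeled CTMC and let $\varphi=f_1\,\mathcal{U}^{I_1}f_2\,\mathcal{U}^{I_2}\cdots\mathcal{U}^{I_{k-1}} f_k$ ($k\ge 2$) be a CSL path formula whose subformulas $f_1,\dots,f_k$ are atomic propositions. Let $\mathcal{B}_\varphi$ be the formula automaton of $\varphi$ and $\mathcal{C}\times\mathcal{B}_\varphi$ the product CTMC. For $s\in S$ let $s_B=(s,\delta(q_1,L(s)))$ be the corresponding state of the product. Then: (1) the sub-CTMC $(\mathcal{C}\times\mathcal{B}_\varphi)|_{s_B}$ is stratified with respect to $\varphi$; (2) $\mathrm{Pr}^{\mathcal{C}}_s(\varphi)=\mathrm{Pr}^{(\mathcal{C}\times\mathcal{B}_\varphi)|_{s_B}}_{s_B}(\varphi)=\mathrm{Pr}^{\mathcal{C}\times\mathcal{B}_\varphi}_{s_B}(\varphi)$, where in the product the formula $\varphi$ is interpreted with respect to the product labeling $L'$.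
   Context: A labeled CTMC is $\mathcal{C}=(S,\mathbf{R},L)$ with $S$ a finite set of states, rate matrix $\mathbf{R}:S\times S\to\mathbb{R}_{\ge 0}$, and labeling $L:S\to 2^{AP}$ ($AP$ a set of atomic propositions). $E(s)=\sum_{s'}\mathbf{R}(s,s')$ is the exit rate; $s$ is absorbing if $E(s)=0$. An infinite path is a sequence $s_0\,t_0\,s_1\,t_1\cdots$ with $\mathbf{R}(s_i,s_{i+1})>0$ and $t_i\in\mathbb{R}_{>0}$; a finite path is $s_0\,t_0\cdots s_{n-1}\,t_{n-1}\,s_n$ with $\mathbf{R}(s_i,s_{i+1})>0$, $t_i>0$, $s_n$ absorbing, and one sets $t_n:=\infty$. For a path $\sigma$ and $t\ge 0$, $\sigma@t$ denotes $s_i$ where $i$ is the smallest index with $t<\sum_{j=0}^i t_j$. For states $s_0,\dots,s_m$ with $\mathbf{R}(s_i,s_{i+1})>0$ and nonempty intervals $I_0,\dots,I_{m-1}\subseteq\mathbb{R}_{\ge0}$, the cylinder set $\mathit{Cyl}(s_0,I_0,\dots,I_{m-1},s_m)$ is the set of paths whose $i$-th state is $s_i$ ($i\le m$) and whose $i$-th sojourn time $t_i$ lies in $I_i$ ($i<m$). For an initial distribution $\alpha$ on $S$, $\mathrm{Pr}^{\mathcal{C}}_\alpha$ is the unique probability measure on the $\sigma$-algebra generated by cylinder sets with $\mathrm{Pr}_\alpha(\mathit{Cyl}(s))=\alpha(s)$ and $\mathrm{Pr}_\alpha(\mathit{Cyl}(s_0,I_0,\dots,I_{m-1},s_m))=\mathrm{Pr}_\alpha(\mathit{Cyl}(s_0,\dots,s_{m-1}))\cdot\frac{\mathbf{R}(s_{m-1},s_m)}{E(s_{m-1})}\cdot\big(e^{-E(s_{m-1})\inf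 I_{m-1}}-e^{-E(s_{m-1})\sup I_{m-1}}\big)$; $\mathrm{Pr}_s$ denotes $\mathrm{Pr}_\alpha$ for $\alpha$ the Dirac distribution at $s$. CSL path formula: $\varphi=f_1\,\mathcal{U}^{I_1}f_2\cdots\mathcal{U}^{I_{k-1}}f_k$ with $k\ge2$, $f_i\in AP$ and $I_i$ nonempty intervals in $\mathbb{R}_{\ge0}$. A path $\sigma$ satisfies $\varphi$ iff there exist reals $0\le t_1\le\cdots\le t_{k-1}$ such that $f_k\in L(\sigma@t_{k-1})$ and for every $0<i<k$: $t_i\in I_i$ and $f_i\in L(\sigma@t')$ for all $t'\in[t_{i-1},t_i)$, where $t_0:=0$. $\mathrm{Pr}_s(\varphi)$ is the $\mathrm{Pr}_s$-measure of the set of paths starting in $s$ satisfying $\varphi$. Stratified CTMC: for a state $s$, let $f^s_{\min}=f_j$ with $j=\min\{i\mid f_i\in L(s)\}$ if this set is nonempty, else $f^s_{\min}=\bot$; order $f_i\sqsubseteq f_j$ iff $i\le j$. $\mathcal{C}$ is stratified w.r.t. $\varphi$ iff for all $s_1,s_2$: if $f^{s_1}_{\min}=\bot$ or $f^{s_1}_{\min}=f_k$ then $\mathbf{R}(s_1,s_2)=0$; otherwise, if $\mathbf{R}(s_1,s_2)>0$ and $f^{s_2}_{\min}\neq\bot$ then $f^{s_1}_{\min}\sqsubseteq f^{s_2}_{\min}$. Formula automaton $\mathcal{B}_\varphi$: deterministic finite automaton over alphabet $\Sigma=2^{\{f_1,\dots,f_k\}}$ with states $Q=\{q_1,\dots,q_k,\bot\}$,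 initial state $q_1$, final states $\{q_1,\dots,q_k\}$, and transition function: for $i<k$ and $a\in\Sigma$ (also applied to $a=L(s)$, reading only the $f$'s in it), $\delta(q_i,a)=q_j$ if $i\le j\le k$, $f_i,\dots,f_{j-1}\notin a$ and $f_j\in a$; $\delta(q_i,a)=\bot$ if no such $j$ exists; $q_k$ and $\bot$ are absorbing ($\delta(q_k,a)=q_k$, $\delta(\bot,a)=\bot$). Product CTMC $\mathcal{C}\times\mathcal{B}_\varphi=(S\times Q,\mathbf{R}',L')$: $\mathbf{R}'((s,q_i),(s',q'))=\mathbf{R}(s,s')$ if $f_j\in L(s)$ for some $j\in\{i,\dots,k-1\}$ and $q'=\delta(q_i,L(s'))$, and $0$ otherwise; all states $(s,\bot)$ are absorbing; $L'(s,q_i)=L(s)\setminus\{f_1,\dots,f_{i-1}\}$ and $L'(s,\bot)=\emptyset$. For a CTMC $\mathcal{C}$ and state $x$, $\mathcal{C}|_x$ is the sub-CTMC on the states reachable from $x$ via positive-rate transitions, with $\mathbf{R}$ and $L$ restricted.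
   Formalization: The atomic propositions f_1,…,f_k are assumed pairwise distinct; with repetitions the order on the f_i is ill-defined and claim (2) fails, e.g. for a U^{[1,2]} b U^{[3,4]} a on a chain {a}→{b}→{a}. *)

theory Defs
  imports "HOL-Probability.Probability"
begin

definition ctmc :: "'s set \<Rightarrow> ('s \<Rightarrow> 's \<Rightarrow> real) \<Rightarrow> bool" where
  "ctmc S R \<longleftrightarrow> finite S \<and> (\<forall>s s'. 0 \<le> R s s') \<and> (\<forall>s s'. R s s' \<noteq> 0 \<longrightarrow> s \<in> S \<and> s' \<in> S)"

definition exit_rate :: "'s set \<Rightarrow> ('s \<Rightarrow> 's \<Rightarrow> real) \<Rightarrow> 's \<Rightarrow> real" where
  "exit_rate S R s = (\<Sum>s'\<in>S. R s s')"

definition valid_interval :: "real set \<Rightarrow> bool" where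
  "valid_interval I \<longleftrightarrow> I \<noteq> {} \<and> I \<subseteq> {0..} \<and> is_interval I"

text \<open>Paths: sequences of (state, sojourn time). A finite path s0 t0 ... s_n (s_n absorbing,
  t_n = infinity) is encoded by repeating (s_n, infinity) forever.\<close>

type_synonym 's path = "nat \<Rightarrow> 's \<times> ereal"

definition paths :: "'s set \<Rightarrow> ('s \<Rightarrow> 's \<Rightarrow> real) \<Rightarrow> 's path set" where
  "paths S R = {\<omega>. \<forall>i. fst (\<omega> i) \<in> S \<and>
     ((0 < R (fst (\<omega> i)) (fst (\<omega> (Suc i))) \<and> 0 < snd (\<omega> i) \<and> snd (\<omega> i) < \<infinity>) \<or>
      (exit_rate S R (fst (\<omega> i)) = 0 \<and> snd (\<omega> i) = \<infinity> \<and> fst (\<omega> (Suc i)) = fst (\<omega> i)))}"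

definition cyl :: "'s set \<Rightarrow> ('s \<Rightarrow> 's \<Rightarrow> real) \<Rightarrow> 's list \<Rightarrow> real set list \<Rightarrow> 's path set" where
  "cyl S R ss Is = {\<omega> \<in> paths S R. (\<forall>i<length ss. fst (\<omega> i) = ss ! i) \<and>
                                     (\<forall>i<length Is. \<exists>t\<in>Is ! i. snd (\<omega> i) = ereal t)}"

definition valid_cyl :: "'s set \<Rightarrow> ('s \<Rightarrow> 's \<Rightarrow> real) \<Rightarrow> 's list \<Rightarrow> real set list \<Rightarrow> bool" where
  "valid_cyl S R ss Is \<longleftrightarrow> length ss = Suc (length Is) \<and> set ss \<subseteq> S \<and>
     (\<forall>i<length Is. 0 < R (ss ! i) (ss ! Suc i) \<and> valid_interval (Is ! i))"

definition cylinders :: "'s set \<Rightarrow> ('s \<Rightarrow> 's \<Rightarrow> real) \<Rightarrow> 's path set set" where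
  "cylinders S R = {cyl S R ss Is | ss Is. valid_cyl S R ss Is}"

definition exp_prob :: "real \<Rightarrow> real set \<Rightarrow> real" where
  "exp_prob E I = exp (- E * Inf I) - (if bdd_above I then exp (- E * Sup I) else 0)"

definition Pr :: "'s set \<Rightarrow> ('s \<Rightarrow> 's \<Rightarrow> real) \<Rightarrow> ('s \<Rightarrow> real) \<Rightarrow> 's path measure" where
  "Pr S R \<alpha> = (THE M. space M = paths S R \<and> sets M = sigma_sets (paths S R) (cylinders S R) \<and>
     prob_space M \<and>
     (\<forall>s\<in>S. emeasure M (cyl S R [s] []) = ennreal (\<alpha> s)) \<and>
     (\<forall>ss Is. valid_cyl S R ss Is \<and> Is \<noteq> [] \<longrightarrow>
        emeasure M (cyl S R ss Is) =
          emeasure M (cyl S R (butlast ss) (butlast Is)) *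
          ennreal (R (ss ! (length Is - 1)) (ss ! length Is) / exit_rate S R (ss ! (length Is - 1))
                   * exp_prob (exit_rate S R (ss ! (length Is - 1))) (last Is))))"

definition at_time :: "'s path \<Rightarrow> real \<Rightarrow> 's" where
  "at_time \<omega> t = fst (\<omega> (LEAST i. ereal t < (\<Sum>j\<le>i. snd (\<omega> j))))"

text \<open>phi = fs!0 U^{Is!0} fs!1 ... U^{Is!(k-2)} fs!(k-1), with k = length fs (0-indexed).\<close>

definition sat :: "('s \<Rightarrow> 'a set) \<Rightarrow> 'a list \<Rightarrow> real set list \<Rightarrow> 's path \<Rightarrow> bool" where
  "sat L fs Is \<omega> \<longleftrightarrow> (\<exists>ts :: nat \<Rightarrow> real. ts 0 = 0 \<and>
     (\<forall>i. 0 < i \<and> i < length fs \<longrightarrow>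
        ts (i - 1) \<le> ts i \<and> ts i \<in> Is ! (i - 1) \<and>
        (\<forall>t'. ts (i - 1) \<le> t' \<and> t' < ts i \<longrightarrow> fs ! (i - 1) \<in> L (at_time \<omega> t'))) \<and>
     fs ! (length fs - 1) \<in> L (at_time \<omega> (ts (length fs - 1))))"

definition prob_formula :: "'s set \<Rightarrow> ('s \<Rightarrow> 's \<Rightarrow> real) \<Rightarrow> ('s \<Rightarrow> 'a set) \<Rightarrow> 'a list \<Rightarrow> real set list \<Rightarrow> 's \<Rightarrow> real" where
  "prob_formula S R L fs Is s =
     measure (Pr S R (\<lambda>x. if x = s then 1 else 0)) {\<omega> \<in> paths S R. fst (\<omega> 0) = s \<and> sat L fs Is \<omega>}"

text \<open>f^s_min as a (0-based) index, None standing for bottom.\<close>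

definition fmin :: "('s \<Rightarrow> 'a set) \<Rightarrow> 'a list \<Rightarrow> 's \<Rightarrow> nat option" where
  "fmin L fs s = (if \<exists>i<length fs. fs ! i \<in> L s then Some (LEAST i. i < length fs \<and> fs ! i \<in> L s) else None)"

definition stratified :: "'s set \<Rightarrow> ('s \<Rightarrow> 's \<Rightarrow> real) \<Rightarrow> ('s \<Rightarrow> 'a set) \<Rightarrow> 'a list \<Rightarrow> bool" where
  "stratified S R L fs \<longleftrightarrow> (\<forall>s1\<in>S. \<forall>s2\<in>S.
     (if fmin L fs s1 = None \<or> fmin L fs s1 = Some (length fs - 1) then R s1 s2 = 0
      else (0 < R s1 s2 \<and> fmin L fs s2 \<noteq> None \<longrightarrow> the (fmin L fs s1) \<le> the (fmin L fs s2))))"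

text \<open>Automaton states: Some i stands for q_{i+1} (i < k), None for bottom.\<close>

definition aut_states :: "'a list \<Rightarrow> nat option set" where
  "aut_states fs = insert None (Some ` {..<length fs})"

definition delta :: "'a list \<Rightarrow> nat option \<Rightarrow> 'a set \<Rightarrow> nat option" where
  "delta fs q a = (case q of None \<Rightarrow> None
     | Some i \<Rightarrow> if i < length fs - 1 then
                   (if \<exists>j. i \<le> j \<and> j < length fs \<and> fs ! j \<in> a
                    then Some (LEAST j. i \<le> j \<and> j < length fs \<and> fs ! j \<in> a) else None)
                 else Some i)"

definition prod_S :: "'s set \<Rightarrow> 'a list \<Rightarrow> ('s \<times> nat option) set" where
  "prod_S S fs = S \<times> aut_states fs"

definition prod_R :: "('s \<Rightarrow> 's \<Rightarrow> real) \<Rightarrow> ('s \<Rightarrow> 'a set) \<Rightarrow> 'a list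
                      \<Rightarrow> 's \<times> nat option \<Rightarrow> 's \<times> nat option \<Rightarrow> real" where
  "prod_R R L fs x y = (case (x, y) of ((s, q), (s', q')) \<Rightarrow>
     (case q of None \<Rightarrow> 0
      | Some i \<Rightarrow> if (\<exists>j. i \<le> j \<and> j < length fs - 1 \<and> fs ! j \<in> L s) \<and> q' = delta fs (Some i) (L s')
                  then R s s' else 0))"

definition prod_L :: "('s \<Rightarrow> 'a set) \<Rightarrow> 'a list \<Rightarrow> 's \<times> nat option \<Rightarrow> 'a set" where
  "prod_L L fs x = (case x of (s, q) \<Rightarrow>
     (case q of None \<Rightarrow> {} | Some i \<Rightarrow> L s - {fs ! j | j. j < i}))"

definition reach :: "('s \<Rightarrow> 's \<Rightarrow> real) \<Rightarrow> 's \<Rightarrow> 's set" where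
  "reach R x = {y. (x, y) \<in> {(a, b). 0 < R a b}\<^sup>*}"

definition restr_R :: "('s \<Rightarrow> 's \<Rightarrow> real) \<Rightarrow> 's \<Rightarrow> 's \<Rightarrow> 's \<Rightarrow> real" where
  "restr_R R x a b = (if a \<in> reach R x \<and> b \<in> reach R x then R a b else 0)"

definition restr_L :: "('s \<Rightarrow> 's \<Rightarrow> real) \<Rightarrow> ('s \<Rightarrow> 'a set) \<Rightarrow> 's \<Rightarrow> 's \<Rightarrow> 'a set" where
  "restr_L R L x a = (if a \<in> reach R x then L a else {})"

end

theory Submission
  imports Defs
begin

text \<open>
  Let the product path lifted from a path of the CTMC carry along the run of the formula automaton,
  and stop it (with sojourn time \<open>\<infinity>\<close>) as soon as the automaton has reached \<open>q\<^sub>k\<close> or \<open>\<bottom>\<close>. The preimage of a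
  cylinder of the product is a cylinder of the CTMC with the same rates, so the path measure of the
  product is the image of the one of the CTMC; the same holds for every part of the product that is
  closed under transitions.

  The automaton state is always at most the index of the label that a witness \<open>t\<^sub>1 \<le> \<dots> \<le> t\<^sub>k\<^sub>-\<^sub>1\<close> of
  satisfaction currently requires, so removing the smaller labels does no harm: on a path with divergent
  sojourn times, a witness for the path is a witness for its lift and conversely. Explosion is a null
  event because independent exponential times with bounded rates exceed \<open>1\<close> infinitely often.

  As \<open>Pr\<close> is a definite description and \<open>measure\<close> vanishes on non-measurable sets, this needs existence
  and uniqueness of the path measure and measurability of the satisfaction event. The measure is the law
  of a path driven by an independent (successor, sojourn time) pair for every step and state. For
  measurability, the times of a witness can be moved into a countable set of measurable times, because
  the state process is piecewise constant.
\<close>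

section \<open>Cylinders determine the path measure\<close>

text \<open>Drawing a pair for every state at every step, rather than only for the current state,
  lets each step use noise that is fresh whatever the past: a cylinder names the states it visits,
  so it becomes a finite rectangle of a product measure. As the noise of the CTMC also drives the
  lift, both satisfaction probabilities are measures of events on one probability space, to be
  compared sample by sample.

  That comparison uses non-explosion: from the explosion on, \<open>at_time\<close> falls back on an
  unspecified index, and a lift that has been stopped does not explode with its path. Measurability
  must hold on the whole path space, so there the explosion time is treated as one more
  discontinuity.

  The lift keeps all jump times up to its stop, so the very same witness times serve on both sides.
  The delicate direction is from lift to path: a lift stopped in \<open>q_k\<close> shows
  \<open>f_k\<close> forever while the path moves on. This is harmless because a witness asks for
  \<open>f_k\<close> at one instant only, and in \<open>q_k\<close> no earlier label survives.
  \<open>distinct fs\<close> enters because \<open>prod_L\<close> removes propositions, whereas the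
  automaton counts positions.\<close>

lemma exit_rate_pos_iff:
  assumes "ctmc S R"
  shows "0 < exit_rate S R x \<longleftrightarrow> (\<exists>y\<in>S. 0 < R x y)"
proof -
  have fin: "finite S" and nn: "\<And>y. 0 \<le> R x y"
    using assms by (auto simp: ctmc_def)
  have "exit_rate S R x = 0 \<longleftrightarrow> (\<forall>y\<in>S. R x y = 0)" "0 \<le> exit_rate S R x"
    unfolding exit_rate_def using fin nn by (auto simp: sum_nonneg_eq_0_iff sum_nonneg)
  then show ?thesis
    using nn by (metis less_eq_real_def less_irrefl)
qed

lemma exit_rate_nonneg: "ctmc S R \<Longrightarrow> 0 \<le> exit_rate S R x"
  unfolding exit_rate_def ctmc_def by (simp add: sum_nonneg)

lemma ctmc_rateD: "ctmc S R \<Longrightarrow> 0 < R x y \<Longrightarrow> x \<in> S \<and> y \<in> S"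
  unfolding ctmc_def by (metis less_irrefl)

lemma exit_rate_eq_0D: "ctmc S R \<Longrightarrow> exit_rate S R x = 0 \<Longrightarrow> R x y = 0"
  using exit_rate_pos_iff[of S R x] unfolding ctmc_def by (metis less_eq_real_def less_irrefl)

lemma exit_rate_posI: "ctmc S R \<Longrightarrow> 0 < R x y \<Longrightarrow> 0 < exit_rate S R x"
  using exit_rate_eq_0D[of S R x y] exit_rate_nonneg[of S R x] by (cases "exit_rate S R x = 0") auto

definition is_path_measure :: "'s set \<Rightarrow> ('s \<Rightarrow> 's \<Rightarrow> real) \<Rightarrow> ('s \<Rightarrow> real) \<Rightarrow> 's path measure \<Rightarrow> bool" where
  "is_path_measure S R \<alpha> M \<longleftrightarrow> space M = paths S R \<and> sets M = sigma_sets (paths S R) (cylinders S R) \<and>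
     prob_space M \<and>
     (\<forall>s\<in>S. emeasure M (cyl S R [s] []) = ennreal (\<alpha> s)) \<and>
     (\<forall>ss Is. valid_cyl S R ss Is \<and> Is \<noteq> [] \<longrightarrow>
        emeasure M (cyl S R ss Is) =
          emeasure M (cyl S R (butlast ss) (butlast Is)) *
          ennreal (R (ss ! (length Is - 1)) (ss ! length Is) / exit_rate S R (ss ! (length Is - 1))
                   * exp_prob (exit_rate S R (ss ! (length Is - 1))) (last Is)))"

lemma Pr_eq_The: "Pr S R \<alpha> = (THE M. is_path_measure S R \<alpha> M)"
  by (simp add: Pr_def is_path_measure_def)

lemma valid_cyl_butlast:
  assumes "valid_cyl S R ss Is" "Is \<noteq> []"
  shows "valid_cyl S R (butlast ss) (butlast Is)"
proof -
  have "Suc (length Is - Suc 0) = length Is"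
    using assms(2) by (cases Is) auto
  then show ?thesis
    using assms by (auto simp: valid_cyl_def nth_butlast dest!: in_set_butlastD)
qed

lemma valid_cyl_single: "valid_cyl S R [x] [] \<longleftrightarrow> x \<in> S"
  by (auto simp: valid_cyl_def)

text \<open>A path in both cylinders shows that the state lists agree on the common prefix and that
  the intersected intervals are nonempty. So the longer state list, with intervals intersected on
  the prefix, is again a valid cylinder. Without a common path only \<open>{}\<close> remains, which
  is why it is adjoined to the generator.\<close>

lemma cyl_Int:
  assumes v: "valid_cyl S R ss Is" "valid_cyl S R ss' Is'" and le: "length Is \<le> length Is'"
  shows "cyl S R ss Is \<inter> cyl S R ss' Is' \<in> insert {} (cylinders S R)"
proof (cases "cyl S R ss Is \<inter> cyl S R ss' Is' = {}")
  case False
  then obtain \<omega> where w: "\<omega> \<in> cyl S R ss Is" "\<omega> \<in> cyl S R ss' Is'" by auto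
  have ss: "ss ! i = ss' ! i" if "i < length ss" for i
    using w that le v by (auto simp: cyl_def valid_cyl_def)
  define Js where "Js = map (\<lambda>i. if i < length Is then Is ! i \<inter> Is' ! i else Is' ! i) [0..<length Is']"
  have lJ: "length Js = length Is'" by (simp add: Js_def)
  have J: "Js ! i = (if i < length Is then Is ! i \<inter> Is' ! i else Is' ! i)" if "i < length Is'" for i
    using that by (simp add: Js_def)
  have "valid_cyl S R ss' Js"
    unfolding valid_cyl_def
  proof (intro conjI allI impI)
    fix i assume i: "i < length Js"
    show "0 < R (ss' ! i) (ss' ! Suc i)" using v i lJ by (auto simp: valid_cyl_def)
    have I': "valid_interval (Is' ! i)" using v i lJ by (auto simp: valid_cyl_def)
    show "valid_interval (Js ! i)"
    proof (cases "i < length Is")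
      case True
      then have I: "valid_interval (Is ! i)" using v by (auto simp: valid_cyl_def)
      obtain t t' where "t \<in> Is ! i" "snd (\<omega> i) = ereal t" "t' \<in> Is' ! i" "snd (\<omega> i) = ereal t'"
        using w True i lJ unfolding cyl_def mem_Collect_eq by metis
      then have "Is ! i \<inter> Is' ! i \<noteq> {}" by auto
      then show ?thesis
        using I I' True i lJ by (auto simp: J valid_interval_def intro: is_interval_Int)
    qed (use I' i lJ in \<open>auto simp: J\<close>)
  qed (use v lJ in \<open>auto simp: valid_cyl_def\<close>)
  moreover have "cyl S R ss Is \<inter> cyl S R ss' Is' = cyl S R ss' Js"
  proof (intro set_eqI iffI)
    fix \<omega> assume "\<omega> \<in> cyl S R ss Is \<inter> cyl S R ss' Is'"
    then show "\<omega> \<in> cyl S R ss' Js"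
      unfolding cyl_def by (force simp: J lJ)
  next
    fix \<omega> assume *: "\<omega> \<in> cyl S R ss' Js"
    have "\<exists>t\<in>Is' ! i. snd (\<omega> i) = ereal t" if "i < length Is'" for i
      using * that J[OF that] lJ unfolding cyl_def by (auto split: if_splits)
    moreover have "\<exists>t\<in>Is ! i. snd (\<omega> i) = ereal t" if "i < length Is" for i
    proof -
      have "\<exists>t\<in>Js ! i. snd (\<omega> i) = ereal t" using * that lJ le by (simp add: cyl_def)
      then show ?thesis using J[of i] that le by auto
    qed
    moreover have "length ss \<le> length ss'" using v le by (auto simp: valid_cyl_def)
    ultimately show "\<omega> \<in> cyl S R ss Is \<inter> cyl S R ss' Is'"
      using * ss unfolding cyl_def by auto
  qed
  ultimately show ?thesis
    by (auto simp: cylinders_def)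
qed auto

lemma cylinders_subset: "cylinders S R \<subseteq> Pow (paths S R)"
  by (auto simp: cylinders_def cyl_def)

lemma Int_stable_cylinders: "Int_stable (insert {} (cylinders S R))"
proof (rule Int_stableI)
  fix a b assume ab: "a \<in> insert {} (cylinders S R)" "b \<in> insert {} (cylinders S R)"
  show "a \<inter> b \<in> insert {} (cylinders S R)"
  proof (cases "a = {} \<or> b = {}")
    case False
    with ab obtain ss Is ss' Is' where
      "a = cyl S R ss Is" "valid_cyl S R ss Is" "b = cyl S R ss' Is'" "valid_cyl S R ss' Is'"
      by (auto simp: cylinders_def)
    then show ?thesis
      using cyl_Int[of S R ss Is ss' Is'] cyl_Int[of S R ss' Is' ss Is]
      by (cases "length Is \<le> length Is'") (auto simp: Int_commute)
  qed auto
qed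

text \<open>The recursion fixes the measure of every cylinder by induction on its length. Cylinders
  with \<open>{}\<close> form an intersection-stable generator, and those of a single state are a
  finite cover of the path space, so the measures agree.\<close>

lemma is_path_measure_unique:
  assumes "ctmc S R" and M: "is_path_measure S R \<alpha> M" and N: "is_path_measure S R \<alpha> N"
  shows "M = N"
proof (rule measure_eqI_generator_eq_countable[where E = "insert {} (cylinders S R)"
      and A = "(\<lambda>x. cyl S R [x] []) ` S"])
  show "Int_stable (insert {} (cylinders S R))" by (rule Int_stable_cylinders)
  show "insert {} (cylinders S R) \<subseteq> Pow (paths S R)" using cylinders_subset by auto
  have *: "sigma_sets (paths S R) (insert {} (cylinders S R)) = sigma_sets (paths S R) (cylinders S R)"
    by (rule sigma_sets_eqI) (auto intro: sigma_sets.intros)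
  show "sets M = sigma_sets (paths S R) (insert {} (cylinders S R))"
    "sets N = sigma_sets (paths S R) (insert {} (cylinders S R))"
    using M N unfolding * by (auto simp: is_path_measure_def)
  have "emeasure M (cyl S R ss Is) = emeasure N (cyl S R ss Is)" if "valid_cyl S R ss Is" for ss Is
    using that
  proof (induction "length Is" arbitrary: ss Is)
    case 0
    then obtain x where "ss = [x]" "Is = []" "x \<in> S"
      by (cases ss) (auto simp: valid_cyl_def)
    then show ?case using M N by (auto simp: is_path_measure_def)
  next
    case (Suc n)
    then have "Is \<noteq> []" by auto
    then have "emeasure M (cyl S R (butlast ss) (butlast Is)) = emeasure N (cyl S R (butlast ss) (butlast Is))"
      using Suc.hyps(2) by (intro Suc.hyps(1) valid_cyl_butlast Suc.prems) auto
    then show ?case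
      using M N \<open>Is \<noteq> []\<close> Suc.prems by (simp add: is_path_measure_def)
  qed
  then show "emeasure M X = emeasure N X" if "X \<in> insert {} (cylinders S R)" for X
    using that by (auto simp: cylinders_def)
  show "(\<lambda>x. cyl S R [x] []) ` S \<subseteq> insert {} (cylinders S R)"
    using valid_cyl_single[of S R] by (fastforce simp: cylinders_def)
  show "\<Union> ((\<lambda>x. cyl S R [x] []) ` S) = paths S R"
    by (auto simp: cyl_def paths_def)
  show "countable ((\<lambda>x. cyl S R [x] []) ` S)"
    using assms(1) by (auto simp: ctmc_def intro: countable_finite)
  show "emeasure M a \<noteq> \<infinity>" for a
    using M unfolding is_path_measure_def by (metis prob_space.finite_measure finite_measure.emeasure_finite infinity_ennreal_def)
qed

abbreviation path_space :: "'s set \<Rightarrow> ('s \<Rightarrow> 's \<Rightarrow> real) \<Rightarrow> 's path measure" where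
  "path_space S R \<equiv> sigma (paths S R) (cylinders S R)"

lemma sets_path_space: "sets (path_space S R) = sigma_sets (paths S R) (cylinders S R)"
  using cylinders_subset by (rule sets_measure_of)

lemma space_path_space: "space (path_space S R) = paths S R"
  using cylinders_subset by (rule space_measure_of)

lemma cyl_in_sets: "valid_cyl S R ss Is \<Longrightarrow> cyl S R ss Is \<in> sets (path_space S R)"
  unfolding sets_path_space by (rule sigma_sets.Basic) (auto simp: cylinders_def)

text \<open>The recursion in \<open>Pr\<close> unrolled, without the factor for the initial state.
  For a Dirac initial distribution that factor becomes the test \<open>ss ! 0 = s\<close>
  below.\<close>

definition cyl_prob :: "'s set \<Rightarrow> ('s \<Rightarrow> 's \<Rightarrow> real) \<Rightarrow> 's list \<Rightarrow> real set list \<Rightarrow> ennreal" where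
  "cyl_prob S R ss Is = (\<Prod>i<length Is. ennreal (R (ss ! i) (ss ! Suc i) / exit_rate S R (ss ! i)
     * exp_prob (exit_rate S R (ss ! i)) (Is ! i)))"

text \<open>This is how the definite description in \<open>Pr\<close> is evaluated: the cylinder
  probabilities show that the image law satisfies its defining property, and uniqueness does the
  rest. It serves both the CTMC and its product.\<close>

lemma Pr_eq_distr:
  assumes "ctmc S R" "prob_space Z" and G: "G \<in> space Z \<rightarrow> paths S R"
    and sets: "\<And>ss Is. valid_cyl S R ss Is \<Longrightarrow> G -` cyl S R ss Is \<inter> space Z \<in> sets Z"
    and emeas: "\<And>ss Is. valid_cyl S R ss Is \<Longrightarrow>
      emeasure Z (G -` cyl S R ss Is \<inter> space Z) = (if ss ! 0 = s then cyl_prob S R ss Is else 0)"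
  shows "G \<in> measurable Z (path_space S R)"
    and "Pr S R (\<lambda>x. if x = s then 1 else 0) = distr Z (path_space S R) G"
proof -
  show meas: "G \<in> measurable Z (path_space S R)"
    using cylinders_subset G by (rule measurable_measure_of) (auto simp: cylinders_def sets)
  let ?D = "distr Z (path_space S R) G"
  have cyl: "emeasure ?D (cyl S R ss Is) = (if ss ! 0 = s then cyl_prob S R ss Is else 0)"
    if "valid_cyl S R ss Is" for ss Is
    using emeas[OF that] by (subst emeasure_distr[OF meas cyl_in_sets[OF that]])
  have D: "is_path_measure S R (\<lambda>x. if x = s then 1 else 0) ?D"
    unfolding is_path_measure_def
  proof (intro conjI allI impI ballI)
    show "space ?D = paths S R" by (simp add: space_path_space)
    show "sets ?D = sigma_sets (paths S R) (cylinders S R)" by (simp add: sets_path_space)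
    show "prob_space ?D" by (rule prob_space.prob_space_distr[OF assms(2) meas])
    show "emeasure ?D (cyl S R [x] []) = ennreal (if x = s then 1 else 0)" if "x \<in> S" for x
      using cyl[of "[x]" "[]"] that by (simp add: valid_cyl_single cyl_prob_def)
    fix ss Is assume v: "valid_cyl S R ss Is \<and> Is \<noteq> []"
    then obtain m where m: "length Is = Suc m" by (cases Is) auto
    then have l: "length ss = Suc (Suc m)" using v by (auto simp: valid_cyl_def)
    have "cyl_prob S R ss Is = cyl_prob S R (butlast ss) (butlast Is) * ennreal (R (ss ! m) (ss ! Suc m) / exit_rate S R (ss ! m)
     * exp_prob (exit_rate S R (ss ! m)) (Is ! m))"
      unfolding cyl_prob_def by (simp add: m l nth_butlast)
    moreover have "last Is = Is ! m" using m v by (simp add: last_conv_nth)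
    moreover have "butlast ss ! 0 = ss ! 0" using l by (simp add: nth_butlast)
    ultimately show "emeasure ?D (cyl S R ss Is) = emeasure ?D (cyl S R (butlast ss) (butlast Is)) *
          ennreal (R (ss ! (length Is - 1)) (ss ! length Is) / exit_rate S R (ss ! (length Is - 1))
                   * exp_prob (exit_rate S R (ss ! (length Is - 1))) (last Is))"
      using v cyl[of ss Is] cyl[of "butlast ss" "butlast Is"] valid_cyl_butlast[of S R ss Is] m
      by simp
  qed
  show "Pr S R (\<lambda>x. if x = s then 1 else 0) = ?D"
    unfolding Pr_eq_The by (rule the_equality) (use D is_path_measure_unique[OF assms(1)] in auto)
qed

section \<open>Construction of the path measure from independent noise\<close>

text \<open>An interval is known up to its end points. That is enough for Borel measurability, since
  finitely many points are closed, and for exponential laws, which have no atoms.\<close>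

lemma interval_bounds:
  fixes I :: "real set"
  assumes "is_interval I" "I \<noteq> {}" "bdd_below I"
  shows "bdd_above I \<Longrightarrow> {Inf I<..<Sup I} \<subseteq> I \<and> I \<subseteq> {Inf I..Sup I}"
    and "\<not> bdd_above I \<Longrightarrow> {Inf I<..} \<subseteq> I \<and> I \<subseteq> {Inf I..}"
proof -
  have lo: "\<exists>y\<in>I. y < x" if "Inf I < x" for x
    using that assms cInf_less_iff by blast
  have conv: "x \<in> I" if "y \<in> I" "z \<in> I" "y < x" "x < z" for x y z
    using that assms(1) unfolding is_interval_1 by (meson less_imp_le)
  show "{Inf I<..<Sup I} \<subseteq> I \<and> I \<subseteq> {Inf I..Sup I}" if b: "bdd_above I"
  proof -
    have "\<exists>y\<in>I. x < y" if "x < Sup I" for x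
      using that assms b less_cSup_iff by blast
    then have "{Inf I<..<Sup I} \<subseteq> I"
      using lo conv by (meson greaterThanLessThan_iff subsetI)
    moreover have "I \<subseteq> {Inf I..Sup I}"
      using cInf_lower[OF _ assms(3)] cSup_upper[OF _ b] by auto
    ultimately show ?thesis ..
  qed
  show "{Inf I<..} \<subseteq> I \<and> I \<subseteq> {Inf I..}" if b: "\<not> bdd_above I"
  proof -
    have "\<exists>y\<in>I. x < y" for x
      using b unfolding bdd_above_def by (meson not_le)
    then have "{Inf I<..} \<subseteq> I"
      using lo conv by (meson greaterThan_iff subsetI)
    moreover have "I \<subseteq> {Inf I..}"
      using cInf_lower[OF _ assms(3)] by auto
    ultimately show ?thesis ..
  qed
qed

lemma valid_interval_borel:
  assumes "valid_interval I"
  shows "I \<in> sets borel"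
proof -
  have I: "is_interval I" "I \<noteq> {}" "bdd_below I"
    using assms by (auto simp: valid_interval_def bdd_below_def)
  have fin: "I \<inter> {Inf I, Sup I} \<in> sets borel" "I \<inter> {Inf I} \<in> sets borel"
    by (auto intro!: borel_closed finite_imp_closed)
  show ?thesis
  proof (cases "bdd_above I")
    case True
    have "{Inf I<..<Sup I} \<union> (I \<inter> {Inf I, Sup I}) = I"
      using interval_bounds(1)[OF I True] by (auto simp: less_le)
    moreover have "{Inf I<..<Sup I} \<union> (I \<inter> {Inf I, Sup I}) \<in> sets borel"
      using fin(1) by (intro sets.Un) auto
    ultimately show ?thesis by simp
  next
    case False
    have "{Inf I<..} \<union> (I \<inter> {Inf I}) = I"
      using interval_bounds(2)[OF I False] by (auto simp: less_le)
    moreover have "{Inf I<..} \<union> (I \<inter> {Inf I}) \<in> sets borel"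
      using fin(2) by (intro sets.Un) auto
    ultimately show ?thesis by simp
  qed
qed

text \<open>Cylinder intervals may contain \<open>0\<close>, but sojourn times are positive, hence
  the intersection with \<open>{0<..}\<close>. Up to null sets the event is
  \<open>{Inf I<..Sup I}\<close> or \<open>{Inf I<..}\<close>, a difference of distribution function
  values.\<close>

lemma emeasure_exponential_interval:
  assumes E: "0 < E" and I: "valid_interval I"
  shows "emeasure (density lborel (exponential_density E)) (I \<inter> {0<..}) = ennreal (exp_prob E I)"
proof -
  let ?X = "density lborel (exponential_density E)"
  interpret X: prob_space ?X by (rule prob_space_exponential_density[OF E])
  have I': "is_interval I" "I \<noteq> {}" "bdd_below I"
    using I by (auto simp: valid_interval_def bdd_below_def)
  have IB: "I \<in> sets borel" by (rule valid_interval_borel[OF I])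
  have a0: "0 \<le> Inf I"
    using I by (intro cInf_greatest) (auto simp: valid_interval_def)
  have cdf: "X.prob {..a} = 1 - exp (- E * a)" if "0 \<le> a" for a
    using emeasure_erlang_density[of E 0 a] that E
    by (simp add: X.emeasure_eq_measure erlang_CDF_0 ennreal_inj)
  have ne: "AE x in ?X. x \<noteq> c" for c
    using AE_lborel_singleton[of c] by (subst AE_density) auto
  show ?thesis
  proof (cases "bdd_above I")
    case True
    have ab: "Inf I \<le> Sup I" using I' True by (intro cInf_le_cSup)
    have "AE x in ?X. x \<in> I \<inter> {0<..} \<longleftrightarrow> x \<in> {Inf I<..Sup I}"
      using ne[of "Inf I"] ne[of "Sup I"]
    proof eventually_elim
      case (elim x)
      have "x \<in> I \<Longrightarrow> Inf I \<le> x \<and> x \<le> Sup I" "Inf I < x \<Longrightarrow> x < Sup I \<Longrightarrow> x \<in> I"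
        using interval_bounds(1)[OF I' True] by auto
      then show ?case
        using a0 elim by (cases "x \<in> I") auto
    qed
    then have "emeasure ?X (I \<inter> {0<..}) = emeasure ?X {Inf I<..Sup I}"
      using IB by (intro emeasure_eq_AE) auto
    also have "{Inf I<..Sup I} = {..Sup I} - {..Inf I}" by auto
    also have "emeasure ?X \<dots> = ennreal (X.prob {..Sup I} - X.prob {..Inf I})"
      using ab by (subst X.emeasure_eq_measure, subst X.finite_measure_Diff) auto
    finally show ?thesis
      using a0 ab True by (simp add: cdf exp_prob_def)
  next
    case False
    have "AE x in ?X. x \<in> I \<inter> {0<..} \<longleftrightarrow> x \<in> {Inf I<..}"
      using ne[of "Inf I"]
    proof eventually_elim
      case (elim x)
      have "x \<in> I \<Longrightarrow> Inf I \<le> x" "Inf I < x \<Longrightarrow> x \<in> I"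
        using interval_bounds(2)[OF I' False] by auto
      then show ?case
        using a0 elim by (cases "x \<in> I") auto
    qed
    then have "emeasure ?X (I \<inter> {0<..}) = emeasure ?X {Inf I<..}"
      using IB by (intro emeasure_eq_AE) auto
    also have "{Inf I<..} = space ?X - {..Inf I}" by auto
    also have "emeasure ?X \<dots> = ennreal (1 - X.prob {..Inf I})"
      by (subst X.emeasure_eq_measure, subst X.prob_compl) auto
    finally show ?thesis
      using a0 False by (simp add: cdf exp_prob_def)
  qed
qed

text \<open>The restriction to \<open>{0<..}\<close> makes every noise sample, not just almost every
  one, produce an element of \<open>paths\<close>.\<close>

definition wait_law :: "real \<Rightarrow> real measure" where
  "wait_law E = restrict_space (density lborel (exponential_density E)) {0<..}"

text \<open>The space contains only successors of positive rate, again so that all samples yield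
  paths. In an absorbing state the chain stays where it is, as the encoding of finite paths
  demands.\<close>

definition jump_law :: "'s set \<Rightarrow> ('s \<Rightarrow> 's \<Rightarrow> real) \<Rightarrow> 's \<Rightarrow> 's measure" where
  "jump_law S R x = (if exit_rate S R x = 0 then point_measure {x} (\<lambda>_. 1)
     else point_measure {y\<in>S. 0 < R x y} (\<lambda>y. ennreal (R x y / exit_rate S R x)))"

text \<open>In an absorbing state the noise is irrelevant; the junk choice \<open>1\<close> of the rate only keeps it a
  probability measure.\<close>

definition step_law :: "'s set \<Rightarrow> ('s \<Rightarrow> 's \<Rightarrow> real) \<Rightarrow> 's \<Rightarrow> ('s \<times> real) measure" where
  "step_law S R x = jump_law S R x \<Otimes>\<^sub>M wait_law (if exit_rate S R x = 0 then 1 else exit_rate S R x)"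

text \<open>One independent pair for each state; a path consults only the pair of the state it is
  in. The unread entries are what keeps the layers independent of the course of the chain.\<close>

abbreviation layer :: "'s set \<Rightarrow> ('s \<Rightarrow> 's \<Rightarrow> real) \<Rightarrow> ('s \<Rightarrow> 's \<times> real) measure" where
  "layer S R \<equiv> PiM S (step_law S R)"

abbreviation noise :: "'s set \<Rightarrow> ('s \<Rightarrow> 's \<Rightarrow> real) \<Rightarrow> (nat \<Rightarrow> 's \<Rightarrow> 's \<times> real) measure" where
  "noise S R \<equiv> PiM UNIV (\<lambda>_. layer S R)"

lemma emeasure_wait_law:
  assumes "0 < E" "valid_interval I"
  shows "emeasure (wait_law E) (I \<inter> {0<..}) = ennreal (exp_prob E I)" "I \<inter> {0<..} \<in> sets (wait_law E)"
  unfolding wait_law_def using emeasure_exponential_interval[OF assms] valid_interval_borel[OF assms(2)]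
  by (auto simp: emeasure_restrict_space sets_restrict_space_iff)

lemma space_wait_law: "space (wait_law E) = {0<..}"
  by (simp add: wait_law_def space_restrict_space)

lemma prob_space_wait_law:
  assumes "0 < E"
  shows "prob_space (wait_law E)"
proof (rule prob_spaceI)
  have "valid_interval {0..}" by (auto simp: valid_interval_def is_interval_1)
  then have "emeasure (wait_law E) ({0..} \<inter> {0<..}) = ennreal (exp_prob E {0..})"
    by (rule emeasure_wait_law[OF assms])
  also have "exp_prob E {0..} = 1"
  proof -
    have "\<not> bdd_above {0::real..}"
      unfolding bdd_above_def by (metis atLeast_iff gt_ex less_le_not_le linear order_trans)
    then show ?thesis
      by (simp add: exp_prob_def)
  qed
  also have "{0..} \<inter> {0<..} = space (wait_law E)"
    by (auto simp: space_wait_law)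
  finally show "emeasure (wait_law E) (space (wait_law E)) = 1"
    by simp
qed

lemma space_jump_law:
  "space (jump_law S R x) = (if exit_rate S R x = 0 then {x} else {y\<in>S. 0 < R x y})"
  by (simp add: jump_law_def space_point_measure)

lemma emeasure_jump_law:
  assumes "ctmc S R" "0 < R x y"
  shows "emeasure (jump_law S R x) {y} = ennreal (R x y / exit_rate S R x)" "{y} \<in> sets (jump_law S R x)"
proof -
  have "y \<in> S" "finite S" "exit_rate S R x \<noteq> 0"
    using assms exit_rate_posI[OF assms] ctmc_rateD[OF assms] by (auto simp: ctmc_def)
  then show "emeasure (jump_law S R x) {y} = ennreal (R x y / exit_rate S R x)" "{y} \<in> sets (jump_law S R x)"
    using assms(2) by (auto simp: jump_law_def emeasure_point_measure_finite sets_point_measure)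
qed

lemma prob_space_jump_law:
  assumes "ctmc S R"
  shows "prob_space (jump_law S R x)"
proof (rule prob_spaceI)
  show "emeasure (jump_law S R x) (space (jump_law S R x)) = 1"
  proof (cases "exit_rate S R x = 0")
    case False
    have fin: "finite S" and nn: "\<And>y. 0 \<le> R x y" using assms by (auto simp: ctmc_def)
    have "(\<Sum>y | y \<in> S \<and> 0 < R x y. ennreal (R x y / exit_rate S R x)) =
        ennreal (\<Sum>y | y \<in> S \<and> 0 < R x y. R x y / exit_rate S R x)"
      using nn exit_rate_nonneg[OF assms] by (intro sum_ennreal) auto
    also have "(\<Sum>y | y \<in> S \<and> 0 < R x y. R x y / exit_rate S R x) = (\<Sum>y\<in>S. R x y / exit_rate S R x)"
      using fin nn by (intro sum.mono_neutral_left) (auto simp: less_le)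
    also have "\<dots> = 1"
      using False by (simp add: exit_rate_def flip: sum_divide_distrib)
    finally show ?thesis
      using False fin by (simp add: jump_law_def space_point_measure emeasure_point_measure_finite)
  qed (simp add: jump_law_def space_point_measure emeasure_point_measure_finite)
qed

lemma exit_rate_or_1_pos: "ctmc S R \<Longrightarrow> 0 < (if exit_rate S R x = 0 then 1 else exit_rate S R x)"
  using exit_rate_nonneg[of S R x] by auto

lemma prob_space_step_law: "ctmc S R \<Longrightarrow> prob_space (step_law S R x)"
  unfolding step_law_def
  by (intro prob_space_pair prob_space_jump_law prob_space_wait_law exit_rate_or_1_pos)

lemma space_step_law:
  "space (step_law S R x) = (if exit_rate S R x = 0 then {x} else {y\<in>S. 0 < R x y}) \<times> {0<..}"
  by (simp add: step_law_def space_pair_measure space_jump_law space_wait_law)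

lemma emeasure_step_law:
  assumes "ctmc S R" "0 < R x y" "valid_interval I"
  shows "emeasure (step_law S R x) ({y} \<times> (I \<inter> {0<..})) =
      ennreal (R x y / exit_rate S R x * exp_prob (exit_rate S R x) I)"
    and "{y} \<times> (I \<inter> {0<..}) \<in> sets (step_law S R x)"
proof -
  let ?E = "exit_rate S R x"
  have E: "0 < ?E" by (rule exit_rate_posI[OF assms(1,2)])
  interpret W: prob_space "wait_law ?E" by (rule prob_space_wait_law[OF E])
  note w = emeasure_wait_law[OF E assms(3)] and j = emeasure_jump_law[OF assms(1,2)]
  have *: "step_law S R x = jump_law S R x \<Otimes>\<^sub>M wait_law ?E" using E by (simp add: step_law_def)
  show "{y} \<times> (I \<inter> {0<..}) \<in> sets (step_law S R x)"
    unfolding * using w j by (intro pair_measureI)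
  show "emeasure (step_law S R x) ({y} \<times> (I \<inter> {0<..})) =
      ennreal (R x y / exit_rate S R x * exp_prob (exit_rate S R x) I)"
    unfolding * W.emeasure_pair_measure_Times[OF j(2) w(2)] j(1) w(1) using assms(2) E
    by (intro ennreal_mult'[symmetric]) simp
qed

lemma product_prob_space_layer: "ctmc S R \<Longrightarrow> product_prob_space (step_law S R)"
  by (intro product_prob_spaceI prob_space_step_law)

lemma prob_space_layer: "ctmc S R \<Longrightarrow> prob_space (layer S R)"
  by (intro prob_space_PiM prob_space_step_law)

lemma product_prob_space_noise: "ctmc S R \<Longrightarrow> product_prob_space (\<lambda>_. layer S R)"
  by (intro product_prob_spaceI prob_space_layer)

lemma prob_space_noise: "ctmc S R \<Longrightarrow> prob_space (noise S R)"
  by (intro prob_space_PiM prob_space_layer)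

section \<open>Paths driven by the noise\<close>

primrec chain :: "'s \<Rightarrow> (nat \<Rightarrow> 's \<Rightarrow> 's \<times> real) \<Rightarrow> nat \<Rightarrow> 's" where
  "chain s z 0 = s"
| "chain s z (Suc n) = fst (z n (chain s z n))"

definition noise_path :: "'s set \<Rightarrow> ('s \<Rightarrow> 's \<Rightarrow> real) \<Rightarrow> 's \<Rightarrow> (nat \<Rightarrow> 's \<Rightarrow> 's \<times> real) \<Rightarrow> 's path" where
  "noise_path S R s z n = (chain s z n,
     if exit_rate S R (chain s z n) = 0 then \<infinity> else ereal (snd (z n (chain s z n))))"

lemma noise_in_step_space:
  assumes "z \<in> space (noise S R)" "x \<in> S"
  shows "fst (z n x) \<in> (if exit_rate S R x = 0 then {x} else {y\<in>S. 0 < R x y})" "0 < snd (z n x)"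
proof -
  have "z n x \<in> space (step_law S R x)"
    using assms by (auto simp: space_PiM)
  then show "fst (z n x) \<in> (if exit_rate S R x = 0 then {x} else {y\<in>S. 0 < R x y})" "0 < snd (z n x)"
    by (auto simp: space_step_law split: if_splits)
qed

lemma chain_in: "z \<in> space (noise S R) \<Longrightarrow> s \<in> S \<Longrightarrow> chain s z n \<in> S"
proof (induction n)
  case (Suc n)
  then show ?case using noise_in_step_space(1)[of z S R "chain s z n" n] by (auto split: if_splits)
qed simp

lemma noise_path_in_paths:
  assumes "z \<in> space (noise S R)" "s \<in> S"
  shows "noise_path S R s z \<in> paths S R"
  unfolding paths_def
proof (intro CollectI allI)
  fix i
  show "fst (noise_path S R s z i) \<in> S \<and>
     ((0 < R (fst (noise_path S R s z i)) (fst (noise_path S R s z (Suc i))) \<and> 0 < snd (noise_path S R s z i) \<and> snd (noise_path S R s z i) < \<infinity>) \<or>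
      (exit_rate S R (fst (noise_path S R s z i)) = 0 \<and> snd (noise_path S R s z i) = \<infinity> \<and> fst (noise_path S R s z (Suc i)) = fst (noise_path S R s z i)))"
    using noise_in_step_space[OF assms(1) chain_in[OF assms], of i i] chain_in[OF assms, of i]
    by (auto simp: noise_path_def split: if_splits)
qed

text \<open>Once the visited states are prescribed, step \<open>i\<close> reads the entry of layer
  \<open>i\<close> at \<open>ss ! i\<close> and no other. The event therefore constrains one
  coordinate in each of finitely many independent layers. Positive rates along a valid cylinder
  exclude absorbing states before the last one, so the times read are the noise times.\<close>

lemma noise_path_vimage_cyl:
  assumes C: "ctmc S R" and s: "s \<in> S" and v: "valid_cyl S R ss Is"
  shows "noise_path S R s -` cyl S R ss Is \<inter> space (noise S R) =
    (if ss ! 0 = s then {z\<in>space (noise S R). \<forall>i\<in>{..<length Is}.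
       z i \<in> {w\<in>space (layer S R). w (ss ! i) \<in> {ss ! Suc i} \<times> (Is ! i \<inter> {0<..})}} else {})"
proof -
  have l: "length ss = Suc (length Is)" using v by (simp add: valid_cyl_def)
  show ?thesis
  proof (cases "ss ! 0 = s")
    case False
    then show ?thesis using l by (auto simp: cyl_def noise_path_def)
  next
    case True
    have "noise_path S R s z \<in> cyl S R ss Is \<longleftrightarrow>
        (\<forall>i<length Is. z i (ss ! i) \<in> {ss ! Suc i} \<times> (Is ! i \<inter> {0<..}))" (is "?l \<longleftrightarrow> ?r")
      if z: "z \<in> space (noise S R)" for z
    proof
      assume ?l
      then have w: "chain s z i = ss ! i" if "i \<le> length Is" for i
        using that l by (auto simp: cyl_def noise_path_def)
      show ?r
      proof (intro allI impI)
        fix i assume i: "i < length Is"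
        have "ss ! i \<in> S" using v i l unfolding valid_cyl_def by auto
        then have "0 < snd (z i (ss ! i))" using noise_in_step_space[OF z] by blast
        moreover have "\<exists>t\<in>Is ! i. snd (noise_path S R s z i) = ereal t" using \<open>?l\<close> i by (auto simp: cyl_def)
        then have "snd (z i (ss ! i)) \<in> Is ! i"
          using w[of i] i by (auto simp: noise_path_def split: if_splits)
        moreover have "fst (z i (ss ! i)) = ss ! Suc i"
          using w[of i] w[of "Suc i"] i by simp
        ultimately show "z i (ss ! i) \<in> {ss ! Suc i} \<times> (Is ! i \<inter> {0<..})"
          by (cases "z i (ss ! i)") auto
      qed
    next
      assume r: ?r
      have w: "chain s z i = ss ! i" if "i \<le> length Is" for i
        using that
      proof (induction i)
        case (Suc i)
        then have "z i (ss ! i) \<in> {ss ! Suc i} \<times> (Is ! i \<inter> {0<..})" using r by auto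
        then show ?case using Suc by auto
      qed (simp add: True)
      have "\<exists>t\<in>Is ! i. snd (noise_path S R s z i) = ereal t" if "i < length Is" for i
      proof -
        have "0 < R (ss ! i) (ss ! Suc i)" using v that by (auto simp: valid_cyl_def)
        then have "exit_rate S R (ss ! i) \<noteq> 0" using exit_rate_posI[OF C] by fastforce
        moreover have "snd (z i (ss ! i)) \<in> Is ! i" using r that by auto
        ultimately show ?thesis using w[of i] that by (auto simp: noise_path_def)
      qed
      then show ?l
        using w l noise_path_in_paths[OF z s] by (auto simp: cyl_def noise_path_def)
    qed
    then show ?thesis using True
      by (auto simp: space_PiM)
  qed
qed

lemma emeasure_noise_path_cyl:
  assumes C: "ctmc S R" and s: "s \<in> S" and v: "valid_cyl S R ss Is"
  shows "noise_path S R s -` cyl S R ss Is \<inter> space (noise S R) \<in> sets (noise S R)"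
    and "emeasure (noise S R) (noise_path S R s -` cyl S R ss Is \<inter> space (noise S R)) =
      (if ss ! 0 = s then cyl_prob S R ss Is else 0)"
proof -
  let ?B = "\<lambda>i. {w\<in>space (layer S R). w (ss ! i) \<in> {ss ! Suc i} \<times> (Is ! i \<inter> {0<..})}"
  interpret Z: product_prob_space "\<lambda>_. layer S R" UNIV by (rule product_prob_space_noise[OF C])
  interpret L: product_prob_space "step_law S R" S by (rule product_prob_space_layer[OF C])
  have B: "?B i \<in> sets (layer S R)"
    "emeasure (layer S R) (?B i) = ennreal (R (ss ! i) (ss ! Suc i) / exit_rate S R (ss ! i) * exp_prob (exit_rate S R (ss ! i)) (Is ! i))"
    if "i < length Is" for i
  proof -
    have i: "ss ! i \<in> S" "0 < R (ss ! i) (ss ! Suc i)" "valid_interval (Is ! i)"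
      using v that unfolding valid_cyl_def by auto
    note e = emeasure_step_law[OF C i(2,3)]
    show "?B i \<in> sets (layer S R)"
      using measurable_sets[OF measurable_component_singleton[of "ss ! i" S "step_law S R", OF i(1)] e(2)]
      by (simp add: vimage_def Int_def conj_commute)
    show "emeasure (layer S R) (?B i) = ennreal (R (ss ! i) (ss ! Suc i) / exit_rate S R (ss ! i) * exp_prob (exit_rate S R (ss ! i)) (Is ! i))"
      using L.emeasure_PiM_Collect_single[OF i(1) e(2)] e(1) by simp
  qed
  have "{z\<in>space (noise S R). \<forall>i\<in>{..<length Is}. z i \<in> ?B i} \<in> sets (noise S R)"
  proof (rule sets.sets_Collect_finite_All)
    fix i assume "i \<in> {..<length Is}"
    then show "{z \<in> space (noise S R). z i \<in> ?B i} \<in> sets (noise S R)"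
      using measurable_sets[OF measurable_component_singleton[of i UNIV "\<lambda>_. layer S R", OF UNIV_I] B(1)[of i]]
      by (simp add: vimage_def Int_def conj_commute)
  qed auto
  then show "noise_path S R s -` cyl S R ss Is \<inter> space (noise S R) \<in> sets (noise S R)"
    unfolding noise_path_vimage_cyl[OF assms] by simp
  have "emeasure (noise S R) {z\<in>space (noise S R). \<forall>i\<in>{..<length Is}. z i \<in> ?B i} =
      (\<Prod>i\<in>{..<length Is}. emeasure (layer S R) (?B i))"
    by (rule Z.emeasure_PiM_Collect) (use B(1) in auto)
  also have "\<dots> = cyl_prob S R ss Is"
    unfolding cyl_prob_def by (intro prod.cong) (auto simp: B(2))
  finally show "emeasure (noise S R) (noise_path S R s -` cyl S R ss Is \<inter> space (noise S R)) =
      (if ss ! 0 = s then cyl_prob S R ss Is else 0)"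
    unfolding noise_path_vimage_cyl[OF assms] by simp
qed

section \<open>Measurability of the satisfaction event\<close>

lemma path_time_pos: "\<omega> \<in> paths S R \<Longrightarrow> 0 < snd (\<omega> i)"
  unfolding paths_def by (auto dest!: spec[of _ i])

lemma path_absorbed:
  assumes C: "ctmc S R" and w: "\<omega> \<in> paths S R" and "exit_rate S R (fst (\<omega> m)) = 0" "m \<le> i"
  shows "fst (\<omega> i) = fst (\<omega> m)"
  using \<open>m \<le> i\<close>
proof (induction i rule: dec_induct)
  case (step n)
  have "\<not> 0 < R (fst (\<omega> n)) (fst (\<omega> (Suc n)))"
    using exit_rate_posI[OF C, of "fst (\<omega> n)" "fst (\<omega> (Suc n))"] step assms(3) by auto
  then show ?case
    using w step unfolding paths_def by (auto dest!: spec[of _ n])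
qed simp

lemma path_in_cyl:
  assumes w: "\<omega> \<in> paths S R" and Is: "\<And>I. I \<in> set Is \<Longrightarrow> valid_interval I"
    and t: "\<And>j. j < length Is \<Longrightarrow> \<exists>t\<in>Is ! j. snd (\<omega> j) = ereal t"
  defines "ss \<equiv> map (\<lambda>j. fst (\<omega> j)) [0..<Suc (length Is)]"
  shows "valid_cyl S R ss Is" "\<omega> \<in> cyl S R ss Is"
proof -
  have nth: "ss ! j = fst (\<omega> j)" if "j \<le> length Is" for j
    using that unfolding ss_def by (subst nth_map) (auto simp del: upt_Suc)
  have len: "length ss = Suc (length Is)" by (simp add: ss_def)
  have "set ss \<subseteq> S"
    using w unfolding ss_def paths_def by auto
  moreover have "0 < R (ss ! j) (ss ! Suc j)" if "j < length Is" for j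
    using w t[OF that] that nth[of j] nth[of "Suc j"] unfolding paths_def by (auto dest!: spec[of _ j])
  ultimately show "valid_cyl S R ss Is"
    using Is by (auto simp: valid_cyl_def len)
  show "\<omega> \<in> cyl S R ss Is"
    using w t nth by (auto simp: cyl_def len)
qed

lemma valid_interval_atLeast: "valid_interval {0..}" "0 \<le> r \<Longrightarrow> valid_interval {0..r}"
  by (auto simp: valid_interval_def is_interval_1)

lemma path_time_finite_ex:
  assumes "\<omega> \<in> paths S R" "snd (\<omega> j) \<noteq> \<infinity>"
  shows "\<exists>t\<in>{0..}. snd (\<omega> j) = ereal t"
  using path_time_pos[OF assms(1), of j] assms(2) by (cases "snd (\<omega> j)") auto

text \<open>Valid cylinders require positive rates between successive states, so they cannot reach
  index \<open>i\<close> on a path absorbed earlier. \<open>W\<close> therefore also collects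
  shorter cylinders that end in an absorbing state, whose state then persists up to
  \<open>i\<close>.\<close>

lemma pred_path_state:
  assumes C: "ctmc S R"
  shows "Measurable.pred (path_space S R) (\<lambda>\<omega>. P (fst (\<omega> i)))"
proof -
  define W where "W = {(ss, n). set ss \<subseteq> S \<and> length ss \<le> Suc i \<and> n \<le> i \<and> valid_cyl S R ss (replicate n {0..}) \<and>
    P (ss ! n) \<and> (n = i \<or> exit_rate S R (ss ! n) = 0)}"
  have "finite W"
  proof (rule finite_subset)
    show "W \<subseteq> {ss. set ss \<subseteq> S \<and> length ss \<le> Suc i} \<times> {..i}" by (auto simp: W_def)
    show "finite ({ss. set ss \<subseteq> S \<and> length ss \<le> Suc i} \<times> {..i})"
      using C by (intro finite_cartesian_product finite_lists_length_le) (auto simp: ctmc_def)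
  qed
  then have "(\<Union>(ss, n)\<in>W. cyl S R ss (replicate n {0..})) \<in> sets (path_space S R)"
    by (intro sets.finite_UN) (auto simp: W_def intro: cyl_in_sets)
  also have "(\<Union>(ss, n)\<in>W. cyl S R ss (replicate n {0..})) = {\<omega>\<in>paths S R. P (fst (\<omega> i))}"
  proof (intro set_eqI iffI)
    fix \<omega> assume "\<omega> \<in> (\<Union>(ss, n)\<in>W. cyl S R ss (replicate n {0..}))"
    then obtain ss n where W: "(ss, n) \<in> W" and w: "\<omega> \<in> cyl S R ss (replicate n {0..})" by auto
    then have "fst (\<omega> n) = ss ! n" and p: "\<omega> \<in> paths S R"
      by (auto simp: W_def valid_cyl_def cyl_def)
    moreover from this have "fst (\<omega> i) = fst (\<omega> n)"
      using W path_absorbed[OF C p, of n i] by (auto simp: W_def)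
    ultimately show "\<omega> \<in> {\<omega>\<in>paths S R. P (fst (\<omega> i))}"
      using W by (auto simp: W_def)
  next
    fix \<omega> assume "\<omega> \<in> {\<omega>\<in>paths S R. P (fst (\<omega> i))}"
    then have w: "\<omega> \<in> paths S R" and P: "P (fst (\<omega> i))" by auto
    \<comment> \<open>The first infinite sojourn time, capped at \<open>i\<close>: the cylinder of
      length \<open>n\<close> is the longest usable one.\<close>
    define n where "n = (LEAST n. n = i \<or> snd (\<omega> n) = \<infinity>)"
    have n: "n = i \<or> snd (\<omega> n) = \<infinity>"
      unfolding n_def by (rule LeastI[of _ i]) simp
    have ni: "n \<le> i" unfolding n_def by (rule Least_le) simp
    have "snd (\<omega> j) \<noteq> \<infinity>" if "j < n" for j
      using not_less_Least[OF that[unfolded n_def]] by auto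
    then have *: "\<exists>t\<in>replicate n {0..} ! j. snd (\<omega> j) = ereal t" if "j < n" for j
      using path_time_finite_ex[OF w, of j] that by auto
    let ?ss = "map (\<lambda>j. fst (\<omega> j)) [0..<Suc n]"
    have v: "valid_cyl S R ?ss (replicate n {0..})" "\<omega> \<in> cyl S R ?ss (replicate n {0..})"
      using path_in_cyl[OF w, of "replicate n {0..}"] * valid_interval_atLeast by auto
    have nth: "?ss ! n = fst (\<omega> n)"
      by (subst nth_map) (auto simp del: upt_Suc)
    have abs: "n = i \<or> exit_rate S R (fst (\<omega> n)) = 0"
      using n w unfolding paths_def by (auto dest!: spec[of _ n])
    then have "P (fst (\<omega> n))"
      using path_absorbed[OF C w, of n i] ni P by auto
    then have "(?ss, n) \<in> W"
      unfolding W_def mem_Collect_eq prod.case nth using v(1) ni abs by (auto simp: valid_cyl_def)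
    then show "\<omega> \<in> (\<Union>(ss, n)\<in>W. cyl S R ss (replicate n {0..}))"
      using v(2) by auto
  qed
  finally show ?thesis
    by (simp add: pred_def space_path_space)
qed

text \<open>A finite sojourn time at index \<open>i\<close> forces all earlier ones to be finite,
  because an infinite one means absorption for good. So the event is a finite union of cylinders
  with unrestricted intervals before the last one, \<open>{0..r}\<close>.\<close>

lemma borel_measurable_path_time:
  assumes C: "ctmc S R"
  shows "(\<lambda>\<omega>. snd (\<omega> i)) \<in> borel_measurable (path_space S R)"
proof (rule borel_measurableI_le)
  fix y :: ereal
  have "{\<omega>\<in>paths S R. snd (\<omega> i) \<le> y} \<in> sets (path_space S R)"
  proof (cases "\<exists>r. y = ereal r \<and> 0 \<le> r")
    case False
    then consider "y = \<infinity>" | "y < 0" by (cases y) auto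
    then show ?thesis
    proof cases
      case 1
      then show ?thesis
        using sets.top[of "path_space S R"] by (simp add: space_path_space)
    next
      case 2
      have "\<not> snd (\<omega> i) \<le> y" if "\<omega> \<in> paths S R" for \<omega>
        using less_trans[OF 2 path_time_pos[OF that, of i]] by simp
      then have "{\<omega>\<in>paths S R. snd (\<omega> i) \<le> y} = {}" by blast
      then show ?thesis by (simp only: sets.empty_sets)
    qed
  next
    case True
    then obtain r where r: "y = ereal r" "0 \<le> r" by auto
    let ?Is = "replicate i {0..} @ [{0..r}]"
    define W where "W = {ss. set ss \<subseteq> S \<and> length ss \<le> Suc (Suc i) \<and> valid_cyl S R ss ?Is}"
    have "finite W"
    proof (rule finite_subset)
      show "W \<subseteq> {ss. set ss \<subseteq> S \<and> length ss \<le> Suc (Suc i)}" by (auto simp: W_def)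
      show "finite {ss. set ss \<subseteq> S \<and> length ss \<le> Suc (Suc i)}"
        using C by (intro finite_lists_length_le) (auto simp: ctmc_def)
    qed
    then have "(\<Union>ss\<in>W. cyl S R ss ?Is) \<in> sets (path_space S R)"
      by (intro sets.finite_UN) (auto simp: W_def intro: cyl_in_sets)
    also have "(\<Union>ss\<in>W. cyl S R ss ?Is) = {\<omega>\<in>paths S R. snd (\<omega> i) \<le> y}"
    proof (intro set_eqI iffI)
      fix \<omega> assume "\<omega> \<in> (\<Union>ss\<in>W. cyl S R ss ?Is)"
      then have w: "\<omega> \<in> paths S R" and "\<forall>j<Suc i. \<exists>t\<in>?Is ! j. snd (\<omega> j) = ereal t" by (auto simp: cyl_def)
      then have "\<exists>t\<in>?Is ! i. snd (\<omega> i) = ereal t" by blast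
      with w show "\<omega> \<in> {\<omega>\<in>paths S R. snd (\<omega> i) \<le> y}"
        by (auto simp: nth_append r)
    next
      fix \<omega> assume "\<omega> \<in> {\<omega>\<in>paths S R. snd (\<omega> i) \<le> y}"
      then have w: "\<omega> \<in> paths S R" and le: "snd (\<omega> i) \<le> ereal r" by (auto simp: r)
      have "snd (\<omega> j) \<noteq> \<infinity>" if "j \<le> i" for j
      proof
        assume inf: "snd (\<omega> j) = \<infinity>"
        then have "exit_rate S R (fst (\<omega> j)) = 0" using w unfolding paths_def by (auto dest!: spec[of _ j])
        then have "exit_rate S R (fst (\<omega> i)) = 0" using path_absorbed[OF C w _ that] by simp
        then have "\<not> 0 < R (fst (\<omega> i)) (fst (\<omega> (Suc i)))"
          using exit_rate_posI[OF C, of "fst (\<omega> i)" "fst (\<omega> (Suc i))"] by auto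
        then have "snd (\<omega> i) = \<infinity>" using w unfolding paths_def by (auto dest!: spec[of _ i])
        with le show False by simp
      qed
      then have fin: "\<exists>t\<in>{0..}. snd (\<omega> j) = ereal t" if "j \<le> i" for j
        using path_time_finite_ex[OF w] that by blast
      have *: "\<exists>t\<in>?Is ! j. snd (\<omega> j) = ereal t" if "j < length ?Is" for j
        using fin[of j] that le by (cases "j = i") (auto simp: nth_append)
      have "valid_cyl S R (map (\<lambda>j. fst (\<omega> j)) [0..<Suc (length ?Is)]) ?Is"
           "\<omega> \<in> cyl S R (map (\<lambda>j. fst (\<omega> j)) [0..<Suc (length ?Is)]) ?Is"
        using path_in_cyl[OF w, of ?Is, OF _ *] valid_interval_atLeast r by auto
      then show "\<omega> \<in> (\<Union>ss\<in>W. cyl S R ss ?Is)"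
        unfolding W_def valid_cyl_def by (intro UN_I) auto
    qed
    finally show ?thesis .
  qed
  then show "{\<omega> \<in> space (path_space S R). snd (\<omega> i) \<le> y} \<in> sets (path_space S R)"
    by (simp add: space_path_space)
qed

section \<open>Jump times and the piecewise constant state process\<close>

definition jump_time :: "'s path \<Rightarrow> nat \<Rightarrow> ereal" where
  "jump_time \<omega> n = (\<Sum>j<n. snd (\<omega> j))"

lemma at_time_jump_time: "at_time \<omega> t = fst (\<omega> (LEAST i. ereal t < jump_time \<omega> (Suc i)))"
  by (simp add: at_time_def jump_time_def lessThan_Suc_atMost)

lemma jump_time_0: "jump_time \<omega> 0 = 0"
  by (simp add: jump_time_def)

lemma jump_time_Suc: "jump_time \<omega> (Suc n) = jump_time \<omega> n + snd (\<omega> n)"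
  by (simp add: jump_time_def)

lemma jump_time_mono:
  assumes "\<And>i. 0 \<le> snd (\<omega> i)" "m \<le> n"
  shows "jump_time \<omega> m \<le> jump_time \<omega> n"
  unfolding jump_time_def using assms by (intro sum_mono2) auto

lemma path_jump_time_mono: "\<omega> \<in> paths S R \<Longrightarrow> m \<le> n \<Longrightarrow> jump_time \<omega> m \<le> jump_time \<omega> n"
  using path_time_pos[of \<omega> S R] by (intro jump_time_mono) (auto simp: less_imp_le)

text \<open>The alternative \<open>n = 0\<close> covers negative times, at which
  \<open>at_time\<close> gives the initial state; the constancy lemmas below range over all
  reals.\<close>

lemma at_time_eqI:
  assumes w: "\<omega> \<in> paths S R" and "n = 0 \<or> jump_time \<omega> n \<le> ereal t" "ereal t < jump_time \<omega> (Suc n)"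
  shows "at_time \<omega> t = fst (\<omega> n)"
proof -
  have "(LEAST i. ereal t < jump_time \<omega> (Suc i)) = n"
  proof (rule Least_equality)
    fix m assume m: "ereal t < jump_time \<omega> (Suc m)"
    show "n \<le> m"
    proof (rule ccontr)
      assume "\<not> n \<le> m"
      then have "jump_time \<omega> (Suc m) \<le> jump_time \<omega> n" "n \<noteq> 0"
        using path_jump_time_mono[OF w, of "Suc m" n] by auto
      with m assms(2) show False by auto
    qed
  qed fact
  then show ?thesis by (simp add: at_time_jump_time)
qed

lemma jump_index_ex:
  assumes "ereal t < jump_time \<omega> (Suc m)"
  obtains n where "n \<le> m" "n = 0 \<or> jump_time \<omega> n \<le> ereal t" "ereal t < jump_time \<omega> (Suc n)"
proof -
  define n where "n = (LEAST n. ereal t < jump_time \<omega> (Suc n))"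
  have "ereal t < jump_time \<omega> (Suc n)" unfolding n_def using assms by (rule LeastI)
  moreover have "n = 0 \<or> jump_time \<omega> n \<le> ereal t"
  proof (cases n)
    case (Suc k)
    then have "\<not> ereal t < jump_time \<omega> (Suc k)"
      using not_less_Least[of k "\<lambda>n. ereal t < jump_time \<omega> (Suc n)"] unfolding n_def by auto
    then show ?thesis using Suc by auto
  qed simp
  moreover have "n \<le> m" unfolding n_def using assms by (rule Least_le)
  ultimately show ?thesis using that by blast
qed

text \<open>If no sojourn contains \<open>t\<close>, \<open>LEAST\<close> ranges over an empty set.
  The resulting index is unknown but the same for all such \<open>t\<close>, so the state process is
  constant from the explosion on.\<close>

lemma at_time_exploded:
  assumes "\<And>n. jump_time \<omega> n \<le> ereal t"
  shows "at_time \<omega> t = fst (\<omega> (LEAST i. False))"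
proof -
  have "(\<lambda>i. ereal t < jump_time \<omega> (Suc i)) = (\<lambda>_. False)"
    using assms leD by blast
  then show ?thesis by (simp add: at_time_jump_time)
qed

definition explosion_time :: "'s path \<Rightarrow> ereal" where
  "explosion_time \<omega> = (SUP n. jump_time \<omega> n)"

text \<open>Sojourns are closed on the left and open on the right, and past the explosion the
  process is constant.\<close>

lemma at_time_right_const:
  assumes w: "\<omega> \<in> paths S R"
  shows "\<exists>e>0. \<forall>u. t \<le> u \<and> u < t + e \<longrightarrow> at_time \<omega> u = at_time \<omega> t"
proof (cases "\<exists>m. ereal t < jump_time \<omega> (Suc m)")
  case True
  then obtain n where n: "n = 0 \<or> jump_time \<omega> n \<le> ereal t" "ereal t < jump_time \<omega> (Suc n)"
    using jump_index_ex by metis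
  then obtain b where b: "ereal t < ereal b" "ereal b < jump_time \<omega> (Suc n)"
    using ereal_dense2 by blast
  have "at_time \<omega> u = at_time \<omega> t" if "t \<le> u" "u < t + (b - t)" for u
  proof -
    have "at_time \<omega> u = fst (\<omega> n)"
    proof (rule at_time_eqI[OF w])
      show "n = 0 \<or> jump_time \<omega> n \<le> ereal u" using n(1) that(1) by (meson ereal_less_eq(3) order_trans)
      have "ereal u < ereal b" using that by simp
      then show "ereal u < jump_time \<omega> (Suc n)" using b(2) by (rule less_trans)
    qed
    then show ?thesis using at_time_eqI[OF w n] by simp
  qed
  moreover have "0 < b - t" using b(1) by simp
  ultimately show ?thesis by blast
next
  case False
  have j: "jump_time \<omega> n \<le> ereal t" for n
  proof (rule order_trans[OF path_jump_time_mono[OF w, of n "Suc n"]])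
    show "jump_time \<omega> (Suc n) \<le> ereal t" using False by (intro leI) blast
  qed simp
  have ju: "jump_time \<omega> n \<le> ereal u" if "t \<le> u" for n u
    using order_trans[OF j[of n], of "ereal u"] that by simp
  have "at_time \<omega> u = at_time \<omega> t" if "t \<le> u" for u
    unfolding at_time_exploded[OF ju[OF that]] at_time_exploded[OF j] ..
  then show ?thesis
    using zero_less_one by blast
qed

text \<open>Constancy to the left can fail only at the start of a sojourn or at the explosion time;
  the latter is a limit of jump times and need not be one itself.\<close>

lemma at_time_left_const:
  assumes w: "\<omega> \<in> paths S R" and nj: "\<And>n. jump_time \<omega> n \<noteq> ereal t" and ne: "explosion_time \<omega> \<noteq> ereal t"
  shows "\<exists>e>0. \<forall>u. t - e < u \<and> u \<le> t \<longrightarrow> at_time \<omega> u = at_time \<omega> t"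
proof (cases "\<exists>m. ereal t < jump_time \<omega> (Suc m)")
  case True
  then obtain n where n: "n = 0 \<or> jump_time \<omega> n \<le> ereal t" "ereal t < jump_time \<omega> (Suc n)"
    using jump_index_ex by metis
  have "\<exists>a. a < t \<and> (n = 0 \<or> jump_time \<omega> n \<le> ereal a)"
  proof (cases "n = 0")
    case False
    with n(1) nj[of n] have "jump_time \<omega> n < ereal t" by auto
    then show ?thesis using ereal_dense2 by (metis ereal_less(2) less_ereal.simps(1) less_imp_le)
  qed (auto intro: exI[of _ "t - 1"])
  then obtain a where a: "a < t" "n = 0 \<or> jump_time \<omega> n \<le> ereal a" by auto
  have "at_time \<omega> u = at_time \<omega> t" if "t - (t - a) < u" "u \<le> t" for u
  proof -
    have "at_time \<omega> u = fst (\<omega> n)"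
    proof (rule at_time_eqI[OF w])
      have "ereal a \<le> ereal u" using that by simp
      then show "n = 0 \<or> jump_time \<omega> n \<le> ereal u" using a(2) by (meson order_trans)
      have "ereal u \<le> ereal t" using that by simp
      then show "ereal u < jump_time \<omega> (Suc n)" using n(2) by (rule le_less_trans)
    qed
    then show ?thesis using at_time_eqI[OF w n] by simp
  qed
  moreover have "0 < t - a" using a(1) by simp
  ultimately show ?thesis by blast
next
  case False
  have j: "jump_time \<omega> n \<le> ereal t" for n
  proof (rule order_trans[OF path_jump_time_mono[OF w, of n "Suc n"]])
    show "jump_time \<omega> (Suc n) \<le> ereal t" using False by (intro leI) blast
  qed simp
  then have "explosion_time \<omega> \<le> ereal t" unfolding explosion_time_def by (rule SUP_least)
  with ne have "explosion_time \<omega> < ereal t" by simp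
  then obtain a where a: "explosion_time \<omega> < ereal a" "ereal a < ereal t" using ereal_dense2 by blast
  have ja: "jump_time \<omega> n \<le> ereal u" if "t - (t - a) < u" for n u
  proof -
    have "jump_time \<omega> n \<le> explosion_time \<omega>" unfolding explosion_time_def by (rule SUP_upper) simp
    also have "\<dots> \<le> ereal a" using a by simp
    also have "\<dots> \<le> ereal u" using that by simp
    finally show ?thesis .
  qed
  have "0 < t - a" using a(2) by simp
  moreover have "at_time \<omega> u = at_time \<omega> t" if "t - (t - a) < u" for u
    unfolding at_time_exploded[OF ja[OF that]] at_time_exploded[OF j] ..
  ultimately show ?thesis
    by blast
qed

section \<open>Reduction to countably many witness times\<close>

definition sat_at :: "('s \<Rightarrow> 'a set) \<Rightarrow> 'a list \<Rightarrow> real set list \<Rightarrow> 's path \<Rightarrow> (nat \<Rightarrow> real) \<Rightarrow> bool" where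
  "sat_at L fs Is \<omega> ts \<longleftrightarrow> ts 0 = 0 \<and>
     (\<forall>i. 0 < i \<and> i < length fs \<longrightarrow>
        ts (i - 1) \<le> ts i \<and> ts i \<in> Is ! (i - 1) \<and>
        (\<forall>t'. ts (i - 1) \<le> t' \<and> t' < ts i \<longrightarrow> fs ! (i - 1) \<in> L (at_time \<omega> t'))) \<and>
     fs ! (length fs - 1) \<in> L (at_time \<omega> (ts (length fs - 1)))"

lemma sat_iff_sat_at: "sat L fs Is \<omega> \<longleftrightarrow> (\<exists>ts. sat_at L fs Is \<omega> ts)"
  by (simp add: sat_def sat_at_def)

text \<open>By constancy to the right, a rational slightly after \<open>t'\<close> and before
  \<open>b\<close> sees the same state as \<open>t'\<close>.\<close>

lemma sat_at_rat_iff: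
  assumes w: "\<omega> \<in> paths S R"
  shows "(\<forall>t'. a \<le> t' \<and> t' < b \<longrightarrow> P (at_time \<omega> t')) \<longleftrightarrow>
    (\<forall>r. a \<le> of_rat r \<and> of_rat r < b \<longrightarrow> P (at_time \<omega> (of_rat r)))"
proof (intro iffI allI impI)
  fix t' assume *: "\<forall>r. a \<le> of_rat r \<and> of_rat r < b \<longrightarrow> P (at_time \<omega> (of_rat r))" and t': "a \<le> t' \<and> t' < b"
  obtain e where e: "0 < e" "\<And>u. t' \<le> u \<Longrightarrow> u < t' + e \<Longrightarrow> at_time \<omega> u = at_time \<omega> t'"
    using at_time_right_const[OF w, of t'] by blast
  obtain r where "t' < of_rat r" "of_rat r < min b (t' + e)"
    using of_rat_dense[of t' "min b (t' + e)"] t' e(1) by auto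
  then have r: "a \<le> of_rat r" "of_rat r < b" "at_time \<omega> (of_rat r) = at_time \<omega> t'"
    using t' e(2)[of "of_rat r"] by simp_all
  have "P (at_time \<omega> (of_rat r))"
    using * r(1,2) by blast
  then show "P (at_time \<omega> t')"
    unfolding r(3) .
qed auto

text \<open>The instants at which a witness of satisfaction cannot be perturbed: jump times, the explosion
  time and right end points of the intervals. Rational times serve as the perturbed instants.\<close>

definition time_code :: "real set list \<Rightarrow> nat \<times> nat \<Rightarrow> 's path \<Rightarrow> real" where
  "time_code Is c \<omega> = (if fst c = 0 then of_rat (from_nat (snd c))
     else if fst c = 1 then real_of_ereal (jump_time \<omega> (snd c))
     else if fst c = 2 then real_of_ereal (explosion_time \<omega>)
     else Sup (Is ! snd c))"

text \<open>Codes may also denote junk, such as \<open>real_of_ereal\<close> of an infinite jump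
  time or \<open>Sup\<close> of an unbounded interval. Only containment matters: extra candidate
  times do no harm.\<close>

lemma time_codeI:
  "of_rat r \<in> range (\<lambda>c. time_code Is c \<omega>)"
  "jump_time \<omega> n = ereal t \<Longrightarrow> t \<in> range (\<lambda>c. time_code Is c \<omega>)"
  "explosion_time \<omega> = ereal t \<Longrightarrow> t \<in> range (\<lambda>c. time_code Is c \<omega>)"
  "Sup (Is ! n) \<in> range (\<lambda>c. time_code Is c \<omega>)"
  by (rule range_eqI[of _ _ "(0, to_nat r)"], simp add: time_code_def)
     (rule range_eqI[of _ _ "(1, n)"], simp add: time_code_def,
      rule range_eqI[of _ _ "(2, 0)"], simp add: time_code_def,
      rule range_eqI[of _ _ "(3, n)"], simp add: time_code_def)

text \<open>A coded \<open>v\<close> stays. Any other \<open>v\<close> is no discontinuity and no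
  right end point, so a rational just after it sees the same state, lies in the same intervals and
  does not pass the next time in \<open>V\<close>. The constancy to the left in the last conjunct
  accounts for the segment that is gained when a witness time moves right.\<close>

lemma time_code_perturb:
  assumes w: "\<omega> \<in> paths S R" and "finite V" and Is: "\<And>I. I \<in> set Is \<Longrightarrow> valid_interval I"
  shows "\<exists>x. x \<in> range (\<lambda>c. time_code Is c \<omega>) \<and> (v \<in> range (\<lambda>c. time_code Is c \<omega>) \<longrightarrow> x = v) \<and>
    v \<le> x \<and> (\<forall>y\<in>V. v < y \<longrightarrow> x \<le> y) \<and> (\<forall>I\<in>set Is. v \<in> I \<longrightarrow> x \<in> I) \<and> (\<forall>t. v \<le> t \<and> t \<le> x \<longrightarrow> at_time \<omega> t = at_time \<omega> v) \<and>
    (v < x \<longrightarrow> (\<exists>e>0. \<forall>u. v - e < u \<and> u \<le> v \<longrightarrow> at_time \<omega> u = at_time \<omega> v))"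
proof (cases "v \<in> range (\<lambda>c. time_code Is c \<omega>)")
  case True
  then show ?thesis by (intro exI[of _ v]) (auto dest: antisym)
next
  case False
  have left: "\<exists>e>0. \<forall>u. v - e < u \<and> u \<le> v \<longrightarrow> at_time \<omega> u = at_time \<omega> v"
    using False time_codeI(2)[of \<omega> _ v Is] time_codeI(3)[of \<omega> v Is]
    by (intro at_time_left_const[OF w]) blast+
  have "\<forall>\<^sub>F x in at_right v. \<forall>y\<in>V. v < y \<longrightarrow> x \<le> y"
  proof (rule eventually_ball_finite[OF \<open>finite V\<close>], intro ballI)
    fix y
    show "\<forall>\<^sub>F x in at_right v. v < y \<longrightarrow> x \<le> y"
    proof (cases "v < y")
      case True
      then show ?thesis unfolding eventually_at_right_field by (intro exI[of _ y]) auto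
    qed simp
  qed
  moreover have "\<forall>\<^sub>F x in at_right v. \<forall>I\<in>set Is. v \<in> I \<longrightarrow> x \<in> I"
  proof (rule eventually_ball_finite, simp, intro ballI)
    fix I assume I: "I \<in> set Is"
    then obtain n where n: "I = Is ! n" by (metis in_set_conv_nth)
    show "\<forall>\<^sub>F x in at_right v. v \<in> I \<longrightarrow> x \<in> I"
    proof (cases "v \<in> I")
      case True
      \<comment> \<open>If \<open>v\<close> were the largest element of \<open>I\<close>, it would
        be the coded time \<open>Sup I\<close>. So \<open>I\<close> has an element beyond
        \<open>v\<close> and, being convex, everything in between.\<close>
      have "v \<noteq> Sup I" using False time_codeI(4)[of Is n \<omega>] n by metis
      then have "\<not> (\<forall>u\<in>I. u \<le> v)" using True cSup_eq_maximum[of v I] by auto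
      then obtain u where u: "u \<in> I" "v < u" by (auto simp: not_le)
      have "x \<in> I" if "v < x" "x < u" for x
        using Is[OF I] True u that unfolding valid_interval_def is_interval_1 by (meson less_imp_le)
      then show ?thesis
        unfolding eventually_at_right_field using u(2) by (intro exI[of _ u]) auto
    qed simp
  qed
  moreover have "\<forall>\<^sub>F x in at_right v. \<forall>t. v \<le> t \<and> t \<le> x \<longrightarrow> at_time \<omega> t = at_time \<omega> v"
  proof -
    obtain e where e: "0 < e" "\<And>u. v \<le> u \<Longrightarrow> u < v + e \<Longrightarrow> at_time \<omega> u = at_time \<omega> v"
      using at_time_right_const[OF w, of v] by blast
    have "at_time \<omega> t = at_time \<omega> v" if "x < v + e" "v \<le> t" "t \<le> x" for x t
      using that by (intro e(2)) simp_all
    moreover have "v < v + e" using e(1) by simp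
    ultimately show ?thesis
      unfolding eventually_at_right_field by blast
  qed
  ultimately have "\<forall>\<^sub>F x in at_right v. (\<forall>y\<in>V. v < y \<longrightarrow> x \<le> y) \<and> (\<forall>I\<in>set Is. v \<in> I \<longrightarrow> x \<in> I) \<and>
      (\<forall>t. v \<le> t \<and> t \<le> x \<longrightarrow> at_time \<omega> t = at_time \<omega> v)"
    by eventually_elim blast
  then obtain b where b: "v < b" "\<And>x. v < x \<Longrightarrow> x < b \<Longrightarrow> (\<forall>y\<in>V. v < y \<longrightarrow> x \<le> y) \<and> (\<forall>I\<in>set Is. v \<in> I \<longrightarrow> x \<in> I) \<and>
      (\<forall>t. v \<le> t \<and> t \<le> x \<longrightarrow> at_time \<omega> t = at_time \<omega> v)"
    unfolding eventually_at_right_field by blast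
  obtain r where r: "v < of_rat r" "of_rat r < b"
    using of_rat_dense[OF b(1)] by blast
  show ?thesis
  proof (intro exI conjI)
    show "of_rat r \<in> range (\<lambda>c. time_code Is c \<omega>)" by (rule time_codeI(1))
    show "v \<le> of_rat r" using r by simp
    show "v \<in> range (\<lambda>c. time_code Is c \<omega>) \<longrightarrow> of_rat r = v" using False by blast
    show "v < of_rat r \<longrightarrow> (\<exists>e>0. \<forall>u. v - e < u \<and> u \<le> v \<longrightarrow> at_time \<omega> u = at_time \<omega> v)"
      using left by blast
  qed (use b(2)[OF r] in blast)+
qed

text \<open>All witness times are moved by one function \<open>g\<close> of the time, so equal times
  stay equal and the order survives; \<open>0\<close> is rational and stays fixed. The codes are
  kept in a list because lists over \<open>nat \<times> nat\<close>, unlike functions, form a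
  countable type.\<close>

lemma sat_iff_countable:
  assumes w: "\<omega> \<in> paths S R" and len: "0 < length fs" "length Is = length fs - 1"
    and Is: "\<And>I. I \<in> set Is \<Longrightarrow> valid_interval I"
  shows "sat L fs Is \<omega> \<longleftrightarrow> (\<exists>cs. sat_at L fs Is \<omega> (\<lambda>i. time_code Is (cs ! i) \<omega>))"
proof
  assume "sat L fs Is \<omega>"
  then obtain ts where ts: "sat_at L fs Is \<omega> ts" by (auto simp: sat_iff_sat_at)
  let ?V = "ts ` {..<length fs}"
  obtain g where g_all: "\<forall>v. g v \<in> range (\<lambda>c. time_code Is c \<omega>) \<and>
    (v \<in> range (\<lambda>c. time_code Is c \<omega>) \<longrightarrow> g v = v) \<and> v \<le> g v \<and> (\<forall>y\<in>?V. v < y \<longrightarrow> g v \<le> y) \<and>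
    (\<forall>I\<in>set Is. v \<in> I \<longrightarrow> g v \<in> I) \<and> (\<forall>t. v \<le> t \<and> t \<le> g v \<longrightarrow> at_time \<omega> t = at_time \<omega> v) \<and>
    (v < g v \<longrightarrow> (\<exists>e>0. \<forall>u. v - e < u \<and> u \<le> v \<longrightarrow> at_time \<omega> u = at_time \<omega> v))"
  proof (rule exE[OF choice[OF allI]])
    show "\<exists>x. x \<in> range (\<lambda>c. time_code Is c \<omega>) \<and>
      (v \<in> range (\<lambda>c. time_code Is c \<omega>) \<longrightarrow> x = v) \<and> v \<le> x \<and> (\<forall>y\<in>?V. v < y \<longrightarrow> x \<le> y) \<and>
      (\<forall>I\<in>set Is. v \<in> I \<longrightarrow> x \<in> I) \<and> (\<forall>t. v \<le> t \<and> t \<le> x \<longrightarrow> at_time \<omega> t = at_time \<omega> v) \<and>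
      (v < x \<longrightarrow> (\<exists>e>0. \<forall>u. v - e < u \<and> u \<le> v \<longrightarrow> at_time \<omega> u = at_time \<omega> v))" for v
      by (rule time_code_perturb[OF w _ Is]) simp_all
  qed
  have g: "g v \<in> range (\<lambda>c. time_code Is c \<omega>)" "v \<le> g v"
    "y \<in> ?V \<Longrightarrow> v < y \<Longrightarrow> g v \<le> y" "I \<in> set Is \<Longrightarrow> v \<in> I \<Longrightarrow> g v \<in> I"
    "v \<le> t \<Longrightarrow> t \<le> g v \<Longrightarrow> at_time \<omega> t = at_time \<omega> v"
    "v < g v \<Longrightarrow> \<exists>e>0. \<forall>u. v - e < u \<and> u \<le> v \<longrightarrow> at_time \<omega> u = at_time \<omega> v"
    "v \<in> range (\<lambda>c. time_code Is c \<omega>) \<Longrightarrow> g v = v" for v y t I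
    using spec[OF g_all, of v] by blast+
  have "\<exists>k. \<forall>v. v \<in> range (\<lambda>c. time_code Is c \<omega>) \<longrightarrow> time_code Is (k v) \<omega> = v"
    by (rule choice) blast
  then obtain k where k: "\<And>v. v \<in> range (\<lambda>c. time_code Is c \<omega>) \<Longrightarrow> time_code Is (k v) \<omega> = v" by blast
  define ts' where "ts' i = g (ts i)" for i
  define cs where "cs = map (\<lambda>i. k (ts' i)) [0..<length fs]"
  have ts0: "ts 0 = 0" using ts by (simp add: sat_at_def)
  have zero: "0 \<in> range (\<lambda>c. time_code Is c \<omega>)" using time_codeI(1)[of 0 Is \<omega>] by simp
  have cs: "time_code Is (cs ! i) \<omega> = ts' i" if "i < length fs" for i
    using that g(1) by (auto simp: cs_def ts'_def intro!: k)
  have le: "ts i \<le> ts' i" for i using g(2) by (auto simp: ts'_def)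
  have ts'_le: "ts' i \<le> ts j" if "ts i < ts j" "j < length fs" for i j
    using g(3)[of "ts j" "ts i"] that by (auto simp: ts'_def)
  have step: "ts' (i - 1) \<le> ts' i \<and> ts' i \<in> Is ! (i - 1) \<and>
        (\<forall>t'. ts' (i - 1) \<le> t' \<and> t' < ts' i \<longrightarrow> fs ! (i - 1) \<in> L (at_time \<omega> t'))"
    if i: "0 < i" "i < length fs" for i
  proof -
    have o: "ts (i - 1) \<le> ts i" "ts i \<in> Is ! (i - 1)"
      "\<And>t'. ts (i - 1) \<le> t' \<Longrightarrow> t' < ts i \<Longrightarrow> fs ! (i - 1) \<in> L (at_time \<omega> t')"
      using ts i by (auto simp: sat_at_def)
    have gi: "ts' i = g (ts i)" by (simp add: ts'_def)
    have mono: "ts' (i - 1) \<le> ts' i"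
    proof (cases "ts (i - 1) < ts i")
      case True
      then show ?thesis using ts'_le[OF True i(2)] le[of i] by simp
    next
      case False
      then have "ts (i - 1) = ts i" using o(1) by simp
      then show ?thesis by (simp add: ts'_def)
    qed
    have "Is ! (i - 1) \<in> set Is" using i len by auto
    then have "ts' i \<in> Is ! (i - 1)" unfolding gi using g(4) o(2) by blast
    moreover have "fs ! (i - 1) \<in> L (at_time \<omega> t')" if t': "ts' (i - 1) \<le> t'" "t' < ts' i" for t'
    proof (cases "t' < ts i")
      case True
      then show ?thesis using o(3)[of t'] t'(1) le[of "i - 1"] by simp
    next
      case False
      then have eq: "at_time \<omega> t' = at_time \<omega> (ts i)" using g(5)[of "ts i" t'] t' gi by simp
      have lt: "ts (i - 1) < ts i"
      proof (rule ccontr)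
        assume "\<not> ts (i - 1) < ts i"
        then have same: "ts (i - 1) = ts i" using o(1) by simp
        then show False using t' by (simp add: ts'_def)
      qed
      obtain e where e: "0 < e" "\<And>u. ts i - e < u \<Longrightarrow> u \<le> ts i \<Longrightarrow> at_time \<omega> u = at_time \<omega> (ts i)"
        using g(6)[of "ts i"] False t' gi by auto
      \<comment> \<open>On the gained segment the state is the one at \<open>ts i\<close>, hence
        also the one at \<open>u\<close>, which lies just before \<open>ts i\<close> and still in
        the period where the previous label is required.\<close>
      define u where "u = max (ts (i - 1)) (ts i - e / 2)"
      have "ts i - e < u" "u < ts i" "ts (i - 1) \<le> u" using lt e(1) by (auto simp: u_def)
      then show ?thesis using e(2)[of u] o(3)[of u] eq by simp
    qed
    ultimately show ?thesis using mono by blast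
  qed
  have "sat_at L fs Is \<omega> (\<lambda>i. time_code Is (cs ! i) \<omega>)"
    unfolding sat_at_def
  proof (intro conjI allI impI; (elim conjE)?)
    show "time_code Is (cs ! 0) \<omega> = 0"
      using cs[of 0] g(7)[OF zero] ts0 len by (simp add: ts'_def)
    have last: "length fs - 1 < length fs" using len by simp
    have "fs ! (length fs - 1) \<in> L (at_time \<omega> (ts (length fs - 1)))"
      using ts by (simp add: sat_at_def)
    moreover have "at_time \<omega> (ts' (length fs - 1)) = at_time \<omega> (ts (length fs - 1))"
      by (rule g(5)) (auto simp: ts'_def g(2))
    ultimately show "fs ! (length fs - 1) \<in> L (at_time \<omega> (time_code Is (cs ! (length fs - 1)) \<omega>))"
      using cs[OF last] by simp
  next
    fix i assume i: "0 < i" "i < length fs"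
    then have c: "time_code Is (cs ! i) \<omega> = ts' i" "time_code Is (cs ! (i - 1)) \<omega> = ts' (i - 1)"
      by (auto intro!: cs)
    show "time_code Is (cs ! (i - 1)) \<omega> \<le> time_code Is (cs ! i) \<omega>"
      "time_code Is (cs ! i) \<omega> \<in> Is ! (i - 1)"
      using step[OF i] unfolding c by auto
    show "fs ! (i - 1) \<in> L (at_time \<omega> t')"
      if "time_code Is (cs ! (i - 1)) \<omega> \<le> t'" "t' < time_code Is (cs ! i) \<omega>" for t'
      using step[OF i] that unfolding c by auto
  qed
  then show "\<exists>cs. sat_at L fs Is \<omega> (\<lambda>i. time_code Is (cs ! i) \<omega>)"
    by blast
qed (auto simp: sat_iff_sat_at)

lemma borel_measurable_jump_time:
  assumes C: "ctmc S R"
  shows "(\<lambda>\<omega>. jump_time \<omega> n) \<in> borel_measurable (path_space S R)"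
  unfolding jump_time_def by (intro borel_measurable_ereal_sum borel_measurable_path_time[OF C])

lemma borel_measurable_time_code:
  assumes C: "ctmc S R"
  shows "time_code Is c \<in> borel_measurable (path_space S R)"
proof -
  note [measurable] = borel_measurable_jump_time[OF C]
  have [measurable]: "explosion_time \<in> borel_measurable (path_space S R)"
    unfolding explosion_time_def[abs_def] by measurable
  show ?thesis
    unfolding time_code_def[abs_def] by measurable
qed

text \<open>The random index is measurable with countably many values; on each of them a fixed
  coordinate of the path is read.\<close>

lemma pred_at_time:
  assumes C: "ctmc S R" and [measurable]: "\<tau> \<in> borel_measurable (path_space S R)"
  shows "Measurable.pred (path_space S R) (\<lambda>\<omega>. P (at_time \<omega> (\<tau> \<omega>)))"
proof -
  note [measurable] = borel_measurable_jump_time[OF C]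
  have "(\<lambda>\<omega>. LEAST i. ereal (\<tau> \<omega>) < jump_time \<omega> (Suc i)) \<in> measurable (path_space S R) (count_space UNIV)"
    by measurable
  from measurable_compose_countable[OF _ this, of "\<lambda>i \<omega>. P (fst (\<omega> i))"] pred_path_state[OF C]
  show ?thesis
    by (simp add: at_time_jump_time)
qed

text \<open>Satisfaction becomes a countable union over code lists of countable intersections over
  rational instants, on all paths including exploding ones.\<close>

lemma sat_measurable:
  assumes C: "ctmc S R" and len: "0 < length fs" "length Is = length fs - 1"
    and Is: "\<And>I. I \<in> set Is \<Longrightarrow> valid_interval I"
  shows "{\<omega> \<in> paths S R. fst (\<omega> 0) = s \<and> sat L fs Is \<omega>} \<in> sets (path_space S R)"
proof -
  let ?M = "path_space S R"
  define T where "T cs i \<omega> = time_code Is (cs ! i) \<omega>" for cs :: "(nat \<times> nat) list" and i and \<omega> :: "'a path"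
  have T: "T cs i \<in> borel_measurable ?M" for cs i
    unfolding T_def[abs_def] by (rule borel_measurable_time_code[OF C])
  have cmp: "Measurable.pred ?M (\<lambda>\<omega>. f \<omega> \<le> g \<omega>)" "Measurable.pred ?M (\<lambda>\<omega>. f \<omega> < g \<omega>)"
      "Measurable.pred ?M (\<lambda>\<omega>. f \<omega> = g \<omega>)"
    if "f \<in> borel_measurable ?M" "g \<in> borel_measurable ?M" for f g :: "'a path \<Rightarrow> real"
    using borel_measurable_le[OF that] borel_measurable_less[OF that] borel_measurable_eq[OF that]
    by (simp_all add: pred_def)
  have step: "Measurable.pred ?M (\<lambda>\<omega>. 0 < i \<and> i < length fs \<longrightarrow>
        T cs (i - 1) \<omega> \<le> T cs i \<omega> \<and> T cs i \<omega> \<in> Is ! (i - 1) \<and>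
        (\<forall>r. T cs (i - 1) \<omega> \<le> of_rat r \<and> of_rat r < T cs i \<omega> \<longrightarrow> fs ! (i - 1) \<in> L (at_time \<omega> (of_rat r))))" for i cs
  proof (cases "0 < i \<and> i < length fs")
    case True
    have "Is ! (i - 1) \<in> sets borel"
      using True len by (intro valid_interval_borel Is nth_mem) auto
    then have "Measurable.pred ?M (\<lambda>\<omega>. T cs i \<omega> \<in> Is ! (i - 1))"
      by (rule pred_sets2[OF _ T])
    moreover have "Measurable.pred ?M (\<lambda>\<omega>. fs ! (i - 1) \<in> L (at_time \<omega> (of_rat r)))" for r
      by (rule pred_at_time[OF C]) simp
    ultimately show ?thesis
      by (intro pred_intros_logic pred_intros_countable cmp T borel_measurable_const) simp_all
  next
    case False
    then have eq: "(0 < i \<and> i < length fs) = False" by blast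
    show ?thesis unfolding eq simp_thms by (rule measurable_const) simp
  qed
  have last: "Measurable.pred ?M (\<lambda>\<omega>. fs ! (length fs - 1) \<in> L (at_time \<omega> (T cs (length fs - 1) \<omega>)))" for cs
    by (rule pred_at_time[OF C T])
  have first: "Measurable.pred ?M (\<lambda>\<omega>. fst (\<omega> 0) = s)"
    by (rule pred_path_state[OF C])
  have "Measurable.pred ?M (\<lambda>\<omega>. fst (\<omega> 0) = s \<and> (\<exists>cs. T cs 0 \<omega> = 0 \<and> (\<forall>i. 0 < i \<and> i < length fs \<longrightarrow>
        T cs (i - 1) \<omega> \<le> T cs i \<omega> \<and> T cs i \<omega> \<in> Is ! (i - 1) \<and>
        (\<forall>r. T cs (i - 1) \<omega> \<le> of_rat r \<and> of_rat r < T cs i \<omega> \<longrightarrow> fs ! (i - 1) \<in> L (at_time \<omega> (of_rat r)))) \<and>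
        fs ! (length fs - 1) \<in> L (at_time \<omega> (T cs (length fs - 1) \<omega>))))" (is "Measurable.pred ?M ?P")
  proof (intro pred_intros_logic(3)[OF first] pred_intros_countable(2))
    fix cs
    have "Measurable.pred ?M (\<lambda>\<omega>. T cs 0 \<omega> = 0)" by (rule cmp(3)[OF T borel_measurable_const])
    from pred_intros_logic(3)[OF this pred_intros_logic(3)[OF pred_intros_countable(1)[OF step] last]]
    show "Measurable.pred ?M (\<lambda>\<omega>. T cs 0 \<omega> = 0 \<and> (\<forall>i. 0 < i \<and> i < length fs \<longrightarrow>
        T cs (i - 1) \<omega> \<le> T cs i \<omega> \<and> T cs i \<omega> \<in> Is ! (i - 1) \<and>
        (\<forall>r. T cs (i - 1) \<omega> \<le> of_rat r \<and> of_rat r < T cs i \<omega> \<longrightarrow> fs ! (i - 1) \<in> L (at_time \<omega> (of_rat r)))) \<and>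
        fs ! (length fs - 1) \<in> L (at_time \<omega> (T cs (length fs - 1) \<omega>)))" .
  qed
  then have "{\<omega> \<in> space ?M. ?P \<omega>} \<in> sets ?M"
    by (simp add: pred_def)
  also have "{\<omega> \<in> space ?M. ?P \<omega>} = {\<omega> \<in> paths S R. fst (\<omega> 0) = s \<and> sat L fs Is \<omega>}"
    unfolding space_path_space
  proof (rule Collect_cong, rule conj_cong[OF refl], rule conj_cong[OF refl])
    fix \<omega> assume w: "\<omega> \<in> paths S R"
    have rat: "(\<forall>t'. T cs (i - 1) \<omega> \<le> t' \<and> t' < T cs i \<omega> \<longrightarrow> fs ! (i - 1) \<in> L (at_time \<omega> t')) \<longleftrightarrow>
        (\<forall>r. T cs (i - 1) \<omega> \<le> of_rat r \<and> of_rat r < T cs i \<omega> \<longrightarrow> fs ! (i - 1) \<in> L (at_time \<omega> (of_rat r)))" for cs i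
      by (rule sat_at_rat_iff[OF w, where P = "\<lambda>x. fs ! (i - 1) \<in> L x"])
    have "sat L fs Is \<omega> \<longleftrightarrow> (\<exists>cs. sat_at L fs Is \<omega> (\<lambda>i. T cs i \<omega>))"
      unfolding T_def by (rule sat_iff_countable[OF w len Is])
    then show "(\<exists>cs. T cs 0 \<omega> = 0 \<and> (\<forall>i. 0 < i \<and> i < length fs \<longrightarrow>
        T cs (i - 1) \<omega> \<le> T cs i \<omega> \<and> T cs i \<omega> \<in> Is ! (i - 1) \<and>
        (\<forall>r. T cs (i - 1) \<omega> \<le> of_rat r \<and> of_rat r < T cs i \<omega> \<longrightarrow> fs ! (i - 1) \<in> L (at_time \<omega> (of_rat r)))) \<and>
        fs ! (length fs - 1) \<in> L (at_time \<omega> (T cs (length fs - 1) \<omega>))) = sat L fs Is \<omega>"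
      unfolding sat_at_def rat by (rule sym)
  qed
  finally show ?thesis .
qed

section \<open>Lifting paths to the product\<close>

lemma delta_Some_cases:
  assumes "i < length fs - 1"
  obtains "delta fs (Some i) a = None" "\<And>j. i \<le> j \<Longrightarrow> j < length fs \<Longrightarrow> fs ! j \<notin> a"
  | j where "delta fs (Some i) a = Some j" "i \<le> j" "j < length fs" "fs ! j \<in> a"
      "\<And>l. i \<le> l \<Longrightarrow> l < length fs \<Longrightarrow> fs ! l \<in> a \<Longrightarrow> j \<le> l"
proof (cases "\<exists>j. i \<le> j \<and> j < length fs \<and> fs ! j \<in> a")
  case True
  let ?j = "LEAST j. i \<le> j \<and> j < length fs \<and> fs ! j \<in> a"
  have "i \<le> ?j \<and> ?j < length fs \<and> fs ! ?j \<in> a" using True by (rule LeastI_ex)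
  moreover have "?j \<le> l" if "i \<le> l" "l < length fs" "fs ! l \<in> a" for l
    using that by (intro Least_le) auto
  moreover have "delta fs (Some i) a = Some ?j" using True assms by (simp add: delta_def)
  ultimately show ?thesis using that(2) by blast
next
  case False
  then have "delta fs (Some i) a = None" using assms by (auto simp: delta_def)
  then show ?thesis using that(1) False by blast
qed

text \<open>The guard under which \<open>prod_R\<close> lets a product state move. On coherent
  states it says that the automaton is neither in \<open>q_k\<close> nor in bottom.\<close>

definition active :: "('s \<Rightarrow> 'a set) \<Rightarrow> 'a list \<Rightarrow> 's \<times> nat option \<Rightarrow> bool" where
  "active L fs y \<longleftrightarrow> (\<exists>i. snd y = Some i \<and> (\<exists>j. i \<le> j \<and> j < length fs - 1 \<and> fs ! j \<in> L (fst y)))"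

text \<open>The invariant of states entered through \<open>delta\<close>. Arbitrary elements of
  \<open>prod_S\<close> may violate it, as their automaton state need not fit the labels.\<close>

definition coherent :: "('s \<Rightarrow> 'a set) \<Rightarrow> 'a list \<Rightarrow> 's \<times> nat option \<Rightarrow> bool" where
  "coherent L fs y \<longleftrightarrow> (\<forall>i. snd y = Some i \<longrightarrow> i < length fs \<and> fs ! i \<in> L (fst y))"

lemma prod_R_eq:
  "prod_R R L fs y y' = (if active L fs y \<and> snd y' = delta fs (snd y) (L (fst y')) then R (fst y) (fst y') else 0)"
  by (cases y; cases y') (auto simp: prod_R_def active_def split: option.splits)

lemma active_obtain:
  assumes "active L fs y"
  obtains i where "snd y = Some i" "i < length fs - 1"
  using assms by (auto simp: active_def)

lemma active_coherent_iff: "coherent L fs y \<Longrightarrow> active L fs y \<longleftrightarrow> (\<exists>i<length fs - 1. snd y = Some i)"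
  by (auto simp: active_def coherent_def)

lemma coherent_delta: "i < length fs - 1 \<Longrightarrow> coherent L fs (x, delta fs (Some i) (L x))"
  by (rule delta_Some_cases[of i fs "L x"]) (auto simp: coherent_def)

text \<open>The current index is itself a candidate for the least one. So a finite path, encoded by
  repeating its absorbing state, does not move the automaton by the repetitions.\<close>

lemma delta_coherent:
  assumes "coherent L fs y" "active L fs y"
  shows "delta fs (snd y) (L (fst y)) = snd y"
proof -
  obtain i where i: "snd y = Some i" "i < length fs - 1" using assms(2) by (rule active_obtain)
  have "fs ! i \<in> L (fst y)" "i < length fs" using assms(1) i by (auto simp: coherent_def)
  then show ?thesis
    by (cases rule: delta_Some_cases[OF i(2), of "L (fst y)"]) (auto simp: i(1) intro: antisym)
qed

text \<open>Distinctness turns the removal of the propositions \<open>fs ! l\<close> with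
  \<open>l < i\<close> into a condition on positions: \<open>fs ! j\<close> is removed only if
  \<open>j < i\<close>.\<close>

lemma prod_L_iff:
  assumes "distinct fs" "j < length fs" "coherent L fs y"
  shows "fs ! j \<in> prod_L L fs y \<longleftrightarrow> (\<exists>i\<le>j. snd y = Some i \<and> fs ! j \<in> L (fst y))"
proof (cases "snd y")
  case None
  then show ?thesis by (cases y) (simp add: prod_L_def)
next
  case (Some i)
  then have "i < length fs" using assms(3) by (simp add: coherent_def)
  then have "fs ! j \<in> {fs ! l | l. l < i} \<longleftrightarrow> j < i"
    using assms(1,2) by (auto simp: nth_eq_iff_index_eq)
  then show ?thesis using Some by (cases y) (auto simp: prod_L_def)
qed

text \<open>A state that is not active is absorbing in the product, so both components freeze there,
  and the first one may from then on differ from the state of the original path.\<close>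

primrec run :: "('s \<Rightarrow> 'a set) \<Rightarrow> 'a list \<Rightarrow> 's path \<Rightarrow> nat \<Rightarrow> 's \<times> nat option" where
  "run L fs \<omega> 0 = (fst (\<omega> 0), delta fs (Some 0) (L (fst (\<omega> 0))))"
| "run L fs \<omega> (Suc n) = (if active L fs (run L fs \<omega> n)
     then (fst (\<omega> (Suc n)), delta fs (snd (run L fs \<omega> n)) (L (fst (\<omega> (Suc n)))))
     else run L fs \<omega> n)"

definition lift :: "('s \<Rightarrow> 'a set) \<Rightarrow> 'a list \<Rightarrow> 's path \<Rightarrow> ('s \<times> nat option) path" where
  "lift L fs \<omega> n = (run L fs \<omega> n, if active L fs (run L fs \<omega> n) then snd (\<omega> n) else \<infinity>)"

lemma fst_run:
  assumes "\<And>j. j < n \<Longrightarrow> active L fs (run L fs \<omega> j)"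
  shows "fst (run L fs \<omega> n) = fst (\<omega> n)"
  using assms by (cases n) auto

lemma active_run_mono:
  assumes "active L fs (run L fs \<omega> n)" "m \<le> n"
  shows "active L fs (run L fs \<omega> m)"
  using assms(2,1)
proof (induction rule: inc_induct)
  case (step m)
  then show ?case by (cases "active L fs (run L fs \<omega> m)") auto
qed

lemma fst_run_active: "active L fs (run L fs \<omega> n) \<Longrightarrow> fst (run L fs \<omega> n) = fst (\<omega> n)"
  by (rule fst_run) (auto intro: active_run_mono)

lemma jump_time_lift:
  assumes "\<And>j. j < n \<Longrightarrow> active L fs (run L fs \<omega> j)"
  shows "jump_time (lift L fs \<omega>) n = jump_time \<omega> n"
  unfolding jump_time_def using assms by (intro sum.cong) (auto simp: lift_def)

text \<open>It is instantiated with the full product and with its reachable part. Closure under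
  transitions guarantees that cutting the rates at the boundary of \<open>S'\<close> leaves the exit
  rates inside unchanged.\<close>

locale product_ctmc =
  fixes S :: "'s set" and R :: "'s \<Rightarrow> 's \<Rightarrow> real" and L :: "'s \<Rightarrow> 'a set" and fs :: "'a list" and s :: 's
    and S' :: "('s \<times> nat option) set" and R' :: "'s \<times> nat option \<Rightarrow> 's \<times> nat option \<Rightarrow> real"
  assumes C: "ctmc S R" and fs2: "2 \<le> length fs" and s: "s \<in> S"
    and start: "(s, delta fs (Some 0) (L s)) \<in> S'" and S'_subset: "S' \<subseteq> prod_S S fs"
    and closed: "\<And>y y'. y \<in> S' \<Longrightarrow> 0 < prod_R R L fs y y' \<Longrightarrow> y' \<in> S'"
    and R'_eq: "\<And>y y'. R' y y' = (if y \<in> S' \<and> y' \<in> S' then prod_R R L fs y y' else 0)"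
begin

lemma finite_S': "finite S'"
proof (rule finite_subset[OF S'_subset])
  show "finite (prod_S S fs)" using C by (auto simp: prod_S_def aut_states_def ctmc_def)
qed

lemma ctmc_product: "ctmc S' R'"
  using C finite_S' unfolding ctmc_def R'_eq prod_R_eq by auto

lemma R'_pos_iff:
  assumes "y \<in> S'"
  shows "0 < R' y y' \<longleftrightarrow> active L fs y \<and> snd y' = delta fs (snd y) (L (fst y')) \<and> 0 < R (fst y) (fst y')"
    and "0 < R' y y' \<Longrightarrow> R' y y' = R (fst y) (fst y')"
  using assms closed[OF assms, of y'] by (auto simp: R'_eq prod_R_eq split: if_splits)

text \<open>As the automaton is deterministic, each successor of \<open>fst y\<close> has exactly
  one partner among the successors of an active \<open>y\<close>, with the same rate; the sum is
  reindexed along this bijection.\<close>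

lemma exit_rate_product:
  assumes y: "y \<in> S'"
  shows "exit_rate S' R' y = (if active L fs y then exit_rate S R (fst y) else 0)"
proof (cases "active L fs y")
  case True
  let ?h = "\<lambda>x. (x, delta fs (snd y) (L x))"
  let ?P = "{x\<in>S. 0 < R (fst y) x}"
  have nn: "0 \<le> R a b" "0 \<le> R' a' b'" for a b a' b'
    using C ctmc_product unfolding ctmc_def by blast+
  have sub: "?h ` ?P \<subseteq> S'"
  proof safe
    fix x assume "x \<in> S" "0 < R (fst y) x"
    then show "?h x \<in> S'" using True by (intro closed[OF y]) (simp add: prod_R_eq)
  qed
  have "exit_rate S' R' y = (\<Sum>y'\<in>?h ` ?P. R' y y')"
    unfolding exit_rate_def
  proof (rule sum.mono_neutral_right[OF finite_S' sub], intro ballI)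
    fix y' assume y': "y' \<in> S' - ?h ` ?P"
    have "\<not> 0 < R' y y'"
    proof
      assume pos: "0 < R' y y'"
      then have "y' = ?h (fst y')" "0 < R (fst y) (fst y')"
        using R'_pos_iff(1)[OF y, of y'] by (auto simp: prod_eq_iff)
      moreover from this have "fst y' \<in> ?P" using ctmc_rateD[OF C] by blast
      ultimately show False using y' by blast
    qed
    then show "R' y y' = 0" using nn(2)[of y y'] by simp
  qed
  also have "\<dots> = (\<Sum>x\<in>?P. R' y (?h x))"
    by (subst sum.reindex) (auto simp: inj_on_def)
  also have "\<dots> = (\<Sum>x\<in>?P. R (fst y) x)"
  proof (rule sum.cong[OF refl])
    fix x assume "x \<in> ?P"
    then have "0 < R' y (?h x)" using True by (simp add: R'_pos_iff(1)[OF y])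
    from R'_pos_iff(2)[OF y this] show "R' y (?h x) = R (fst y) x" by simp
  qed
  also have "\<dots> = exit_rate S R (fst y)"
    unfolding exit_rate_def
    using C nn(1) by (intro sum.mono_neutral_left) (auto simp: ctmc_def less_le)
  finally show ?thesis using True by simp
next
  case False
  then show ?thesis using y by (simp add: exit_rate_def R'_eq prod_R_eq)
qed

lemma run_invariant:
  assumes w: "\<omega> \<in> paths S R" "fst (\<omega> 0) = s"
  shows "run L fs \<omega> n \<in> S' \<and> coherent L fs (run L fs \<omega> n)"
proof (induction n)
  case 0
  then show ?case using w(2) start fs2 by (auto intro!: coherent_delta)
next
  case (Suc n)
  show ?case
  proof (cases "active L fs (run L fs \<omega> n)")
    case True
    note f = fst_run_active[OF True]
    obtain i where i: "snd (run L fs \<omega> n) = Some i" "i < length fs - 1" using True by (rule active_obtain)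
    have "(0 < R (fst (\<omega> n)) (fst (\<omega> (Suc n)))) \<or> fst (\<omega> (Suc n)) = fst (\<omega> n)"
      using w(1) unfolding paths_def by blast
    then show ?thesis
    proof
      assume "0 < R (fst (\<omega> n)) (fst (\<omega> (Suc n)))"
      then have "run L fs \<omega> (Suc n) \<in> S'"
        using True f by (intro closed[OF conjunct1[OF Suc]]) (simp add: prod_R_eq)
      moreover have "coherent L fs (run L fs \<omega> (Suc n))"
        using coherent_delta[OF i(2)] True by (simp add: i(1))
      ultimately show ?thesis ..
    next
      assume "fst (\<omega> (Suc n)) = fst (\<omega> n)"
      then have "run L fs \<omega> (Suc n) = run L fs \<omega> n"
        using True f delta_coherent[OF conjunct2[OF Suc] True] by (simp add: prod_eq_iff)
      then show ?thesis using Suc by (simp only: simp_thms)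
    qed
  qed (use Suc in simp)
qed

lemma lift_in_paths:
  assumes w: "\<omega> \<in> paths S R" "fst (\<omega> 0) = s"
  shows "lift L fs \<omega> \<in> paths S' R'"
  unfolding paths_def
proof (intro CollectI allI conjI)
  fix n
  let ?y = "run L fs \<omega> n" and ?y' = "run L fs \<omega> (Suc n)"
  have inv: "?y \<in> S'" "coherent L fs ?y" using run_invariant[OF w] by auto
  then show "fst (lift L fs \<omega> n) \<in> S'" by (simp add: lift_def)
  have wn: "(0 < R (fst (\<omega> n)) (fst (\<omega> (Suc n))) \<and> 0 < snd (\<omega> n) \<and> snd (\<omega> n) < \<infinity>) \<or>
      (exit_rate S R (fst (\<omega> n)) = 0 \<and> snd (\<omega> n) = \<infinity> \<and> fst (\<omega> (Suc n)) = fst (\<omega> n))"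
    using w(1) unfolding paths_def by blast
  show "(0 < R' (fst (lift L fs \<omega> n)) (fst (lift L fs \<omega> (Suc n))) \<and> 0 < snd (lift L fs \<omega> n) \<and> snd (lift L fs \<omega> n) < \<infinity>) \<or>
      (exit_rate S' R' (fst (lift L fs \<omega> n)) = 0 \<and> snd (lift L fs \<omega> n) = \<infinity> \<and> fst (lift L fs \<omega> (Suc n)) = fst (lift L fs \<omega> n))"
  proof (cases "active L fs ?y")
    case False
    then show ?thesis using exit_rate_product[OF inv(1)] by (simp add: lift_def)
  next
    case True
    note f = fst_run_active[OF True]
    from wn show ?thesis
    proof (elim disjE conjE)
      assume "0 < R (fst (\<omega> n)) (fst (\<omega> (Suc n)))" "0 < snd (\<omega> n)" "snd (\<omega> n) < \<infinity>"
      then show ?thesis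
        using True f R'_pos_iff(1)[OF inv(1), of ?y'] by (simp add: lift_def)
    next
      assume "exit_rate S R (fst (\<omega> n)) = 0" "snd (\<omega> n) = \<infinity>" "fst (\<omega> (Suc n)) = fst (\<omega> n)"
      then show ?thesis
        using True f delta_coherent[OF inv(2) True] exit_rate_product[OF inv(1)]
        by (simp add: lift_def prod_eq_iff)
    qed
  qed
qed

text \<open>Every state of the cylinder but the last has a positive outgoing rate and so is active,
  where rates and exit rates coincide with those of the CTMC. The last state contributes no
  factor.\<close>

lemma valid_cyl_map_fst:
  assumes v: "valid_cyl S' R' ss Is"
  shows "valid_cyl S R (map fst ss) Is"
    and "cyl_prob S R (map fst ss) Is = cyl_prob S' R' ss Is"
proof -
  have len: "length ss = Suc (length Is)" and sub: "set ss \<subseteq> S'"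
    using v by (auto simp: valid_cyl_def)
  have st: "0 < R' (ss ! i) (ss ! Suc i) \<and> valid_interval (Is ! i)" if "i < length Is" for i
    using v that by (auto simp: valid_cyl_def)
  have i: "ss ! i \<in> S'" if "i < length Is" for i using that len sub by auto
  have pos: "active L fs (ss ! i)" "0 < R (fst (ss ! i)) (fst (ss ! Suc i))"
    "R' (ss ! i) (ss ! Suc i) = R (fst (ss ! i)) (fst (ss ! Suc i))" if "i < length Is" for i
    using R'_pos_iff[OF i[OF that], of "ss ! Suc i"] st[OF that] by auto
  show "valid_cyl S R (map fst ss) Is"
    using len sub S'_subset st pos unfolding valid_cyl_def prod_S_def by auto
  show "cyl_prob S R (map fst ss) Is = cyl_prob S' R' ss Is"
    unfolding cyl_prob_def
    using len pos exit_rate_product[OF i] by (intro prod.cong) auto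
qed

text \<open>Positive rates of the product force each automaton component from the preceding one, so
  beyond the projected cylinder only the first product state has to be checked.\<close>

lemma lift_in_cyl_iff:
  assumes v: "valid_cyl S' R' ss Is" and w: "\<omega> \<in> paths S R" "fst (\<omega> 0) = s"
  shows "lift L fs \<omega> \<in> cyl S' R' ss Is \<longleftrightarrow> ss ! 0 = (s, delta fs (Some 0) (L s)) \<and> \<omega> \<in> cyl S R (map fst ss) Is"
    (is "?l \<longleftrightarrow> ?r")
proof
  have len: "length ss = Suc (length Is)" and sub: "set ss \<subseteq> S'" using v by (auto simp: valid_cyl_def)
  {
    assume l: ?l
    have r: "run L fs \<omega> i = ss ! i" if "i \<le> length Is" for i
      using l that len by (auto simp: cyl_def lift_def)
    have t: "\<exists>t\<in>Is ! i. snd (lift L fs \<omega> i) = ereal t" if "i < length Is" for i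
      using l that by (auto simp: cyl_def)
    \<comment> \<open>Intervals contain only finite times, whereas the lift has sojourn time
      infinity in states that are not active.\<close>
    then have a: "active L fs (run L fs \<omega> i)" if "i < length Is" for i
      using t[OF that] by (auto simp: lift_def split: if_splits)
    have "fst (\<omega> i) = fst (ss ! i)" if "i \<le> length Is" for i
      using fst_run[of i L fs \<omega>] a that r[OF that] by auto
    moreover have "\<exists>t\<in>Is ! i. snd (\<omega> i) = ereal t" if "i < length Is" for i
      using t[OF that] a[OF that] by (simp add: lift_def)
    ultimately show ?r
      using r[of 0] w len by (auto simp: cyl_def)
  }
  {
    assume r: ?r
    have f: "fst (\<omega> i) = fst (ss ! i)" if "i \<le> length Is" for i
      using r that len by (auto simp: cyl_def)
    have st: "active L fs (ss ! i)" "snd (ss ! Suc i) = delta fs (snd (ss ! i)) (L (fst (ss ! Suc i)))"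
      if "i < length Is" for i
    proof -
      have "ss ! i \<in> S'" using that len sub by auto
      then show "active L fs (ss ! i)" "snd (ss ! Suc i) = delta fs (snd (ss ! i)) (L (fst (ss ! Suc i)))"
        using R'_pos_iff(1)[of "ss ! i" "ss ! Suc i"] v that unfolding valid_cyl_def by blast+
    qed
    have run: "run L fs \<omega> i = ss ! i" if "i \<le> length Is" for i
      using that
    proof (induction i)
      case 0
      then show ?case using r w by simp
    next
      case (Suc i)
      then have "run L fs \<omega> (Suc i) = (fst (ss ! Suc i), snd (ss ! Suc i))"
        using st[of i] f[of "Suc i"] by simp
      then show ?case by simp
    qed
    have "\<exists>t\<in>Is ! i. snd (lift L fs \<omega> i) = ereal t" if "i < length Is" for i
      using r run[of i] st[of i] that by (auto simp: cyl_def lift_def)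
    then show ?l
      using run lift_in_paths[OF w] len by (auto simp: cyl_def lift_def)
  }
qed

lemma noise_path_start: "fst (noise_path S R s z 0) = s"
  by (simp add: noise_path_def)

text \<open>The product is driven by the noise of the CTMC, not by a noise of its own, which couples
  the two path measures.\<close>

lemma Pr_product:
  shows "(\<lambda>z. lift L fs (noise_path S R s z)) \<in> measurable (noise S R) (path_space S' R')"
    and "Pr S' R' (\<lambda>x. if x = (s, delta fs (Some 0) (L s)) then 1 else 0) =
      distr (noise S R) (path_space S' R') (\<lambda>z. lift L fs (noise_path S R s z))"
proof -
  let ?G = "\<lambda>z. lift L fs (noise_path S R s z)" and ?sB = "(s, delta fs (Some 0) (L s))"
  have G: "?G \<in> space (noise S R) \<rightarrow> paths S' R'"
    using lift_in_paths noise_path_in_paths[OF _ s] noise_path_start by blast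
  have vim: "?G -` cyl S' R' ss Is \<inter> space (noise S R) =
      (if ss ! 0 = ?sB then noise_path S R s -` cyl S R (map fst ss) Is \<inter> space (noise S R) else {})"
    if v: "valid_cyl S' R' ss Is" for ss Is
    using lift_in_cyl_iff[OF v noise_path_in_paths[OF _ s] noise_path_start] by auto
  have sets: "?G -` cyl S' R' ss Is \<inter> space (noise S R) \<in> sets (noise S R)"
    if v: "valid_cyl S' R' ss Is" for ss Is
    unfolding vim[OF v] using emeasure_noise_path_cyl(1)[OF C s valid_cyl_map_fst(1)[OF v]] by simp
  have emeas: "emeasure (noise S R) (?G -` cyl S' R' ss Is \<inter> space (noise S R)) =
      (if ss ! 0 = ?sB then cyl_prob S' R' ss Is else 0)"
    if v: "valid_cyl S' R' ss Is" for ss Is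
  proof -
    have "0 < length ss" using v by (simp add: valid_cyl_def)
    then show ?thesis
      unfolding vim[OF v] using emeasure_noise_path_cyl(2)[OF C s valid_cyl_map_fst(1)[OF v]] valid_cyl_map_fst(2)[OF v]
      by simp
  qed
  show "?G \<in> measurable (noise S R) (path_space S' R')"
    by (rule Pr_eq_distr(1)[OF ctmc_product prob_space_noise[OF C] G sets emeas])
  show "Pr S' R' (\<lambda>x. if x = ?sB then 1 else 0) = distr (noise S R) (path_space S' R') ?G"
    by (rule Pr_eq_distr(2)[OF ctmc_product prob_space_noise[OF C] G sets emeas])
qed

end

section \<open>Non-explosion\<close>

lemma emeasure_step_law_gt_1:
  assumes C: "ctmc S R"
  shows "{p \<in> space (step_law S R x). 1 < snd p} \<in> sets (step_law S R x)"
    and "emeasure (step_law S R x) {p \<in> space (step_law S R x). 1 < snd p} > 0"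
proof -
  let ?E = "if exit_rate S R x = 0 then 1 else exit_rate S R x"
  have E: "0 < ?E" by (rule exit_rate_or_1_pos[OF C])
  interpret J: prob_space "jump_law S R x" by (rule prob_space_jump_law[OF C])
  interpret W: prob_space "wait_law ?E" by (rule prob_space_wait_law[OF E])
  have I: "valid_interval {1<..}" by (auto simp: valid_interval_def is_interval_1)
  have unb: "\<not> bdd_above {1::real<..}"
    unfolding bdd_above_def
  proof
    assume "\<exists>M. \<forall>x\<in>{1::real<..}. x \<le> M"
    then obtain M where "\<And>x::real. 1 < x \<Longrightarrow> x \<le> M" by auto
    from this[of "\<bar>M\<bar> + 2"] show False by arith
  qed
  have eq: "{p \<in> space (step_law S R x). 1 < snd p} = space (jump_law S R x) \<times> ({1<..} \<inter> {0<..})"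
    unfolding step_law_def space_pair_measure space_wait_law by auto
  show "{p \<in> space (step_law S R x). 1 < snd p} \<in> sets (step_law S R x)"
    unfolding eq unfolding step_law_def by (intro pair_measureI sets.top emeasure_wait_law(2)[OF E I])
  have "emeasure (step_law S R x) {p \<in> space (step_law S R x). 1 < snd p} = ennreal (exp_prob ?E {1<..})"
    unfolding eq unfolding step_law_def
    by (simp only: W.emeasure_pair_measure_Times[OF sets.top emeasure_wait_law(2)[OF E I]]
        J.emeasure_space_1 emeasure_wait_law(1)[OF E I] mult_1)
  also have "\<dots> > 0" using unb by (simp add: exp_prob_def)
  finally show "emeasure (step_law S R x) {p \<in> space (step_law S R x). 1 < snd p} > 0" .
qed

text \<open>Asking all states of a layer for a time above \<open>1\<close> avoids any reference to
  the position of the chain. As \<open>S\<close> is finite this has positive probability, and by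
  independence it fails in \<open>m\<close> successive layers with probability \<open>q ^ m\<close>,
  which tends to \<open>0\<close>.\<close>

lemma AE_noise_recurrent:
  assumes C: "ctmc S R"
  shows "AE z in noise S R. \<forall>N. \<exists>n\<ge>N. \<forall>x\<in>S. 1 < snd (z n x)"
proof -
  interpret PL: prob_space "layer S R" by (rule prob_space_layer[OF C])
  interpret Z: product_prob_space "\<lambda>_. layer S R" UNIV by (rule product_prob_space_noise[OF C])
  interpret L: product_prob_space "step_law S R" S by (rule product_prob_space_layer[OF C])
  have fin: "finite S" using C by (simp add: ctmc_def)
  define B where "B x = {p \<in> space (step_law S R x). 1 < snd p}" for x
  define A where "A = {w \<in> space (layer S R). \<forall>x\<in>S. w x \<in> B x}"
  have B: "B x \<in> sets (step_law S R x)" "emeasure (step_law S R x) (B x) > 0" for x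
    unfolding B_def by (rule emeasure_step_law_gt_1[OF C])+
  have A: "A \<in> sets (layer S R)"
    unfolding A_def
  proof (rule sets.sets_Collect_finite_All[OF _ fin])
    fix x assume x: "x \<in> S"
    show "{w \<in> space (layer S R). w x \<in> B x} \<in> sets (layer S R)"
      using measurable_sets[OF measurable_component_singleton[of x S "step_law S R", OF x] B(1)]
      by (simp add: vimage_def Int_def conj_commute)
  qed
  have "emeasure (layer S R) A = (\<Prod>x\<in>S. emeasure (step_law S R x) (B x))"
    unfolding A_def by (rule L.emeasure_PiM_Collect[OF order_refl fin B(1)])
  also have "\<dots> > 0" using B(2) by (auto simp: zero_less_iff_neq_zero fin)
  finally have p: "PL.prob A > 0" by (simp add: PL.emeasure_eq_measure)
  define q where "q = PL.prob (space (layer S R) - A)"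
  have q: "0 \<le> q" "q < 1" using p PL.prob_compl[OF A] by (auto simp: q_def)
  have "AE z in noise S R. \<exists>n\<ge>N. \<forall>x\<in>S. 1 < snd (z n x)" for N
  proof -
    define F where "F m = {z \<in> space (noise S R). \<forall>n\<in>{N..<N + m}. z n \<in> space (layer S R) - A}" for m
    have Fs: "F m \<in> sets (noise S R)" for m
      unfolding F_def
    proof (rule sets.sets_Collect_finite_All)
      fix n
      show "{z \<in> space (noise S R). z n \<in> space (layer S R) - A} \<in> sets (noise S R)"
        using measurable_sets[OF measurable_component_singleton[of n UNIV "\<lambda>_. layer S R", OF UNIV_I] sets.compl_sets[OF A]]
        by (simp add: vimage_def Int_def conj_commute)
    qed simp
    have Fm: "emeasure (noise S R) (F m) = ennreal (q ^ m)" for m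
    proof -
      have "emeasure (noise S R) (F m) = (\<Prod>n\<in>{N..<N + m}. emeasure (layer S R) (space (layer S R) - A))"
        unfolding F_def by (rule Z.emeasure_PiM_Collect) (use A in auto)
      then show ?thesis
        using q(1) by (simp add: PL.emeasure_eq_measure q_def ennreal_power)
    qed
    show ?thesis
    proof (rule AE_I)
      show "(\<Inter>m. F m) \<in> sets (noise S R)" using Fs by (intro sets.countable_INT) auto
      have le: "emeasure (noise S R) (\<Inter>m. F m) \<le> ennreal (q ^ m)" for m
        unfolding Fm[symmetric] using Fs by (intro emeasure_mono) auto
      have "(\<lambda>m. ennreal (q ^ m)) \<longlonglongrightarrow> ennreal 0"
        using q by (intro tendsto_ennrealI LIMSEQ_realpow_zero)
      then have "emeasure (noise S R) (\<Inter>m. F m) \<le> ennreal 0"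
        by (rule LIMSEQ_le_const) (use le in auto)
      then show "emeasure (noise S R) (\<Inter>m. F m) = 0" by simp
      show "{z \<in> space (noise S R). \<not> (\<exists>n\<ge>N. \<forall>x\<in>S. 1 < snd (z n x))} \<subseteq> (\<Inter>m. F m)"
      proof safe
        fix z m assume z: "z \<in> space (noise S R)" and n: "\<not> (\<exists>n\<ge>N. \<forall>x\<in>S. 1 < snd (z n x))"
        have "z n \<in> space (layer S R) - A" if "N \<le> n" for n
          using z n that by (auto simp: space_PiM A_def B_def)
        then show "z \<in> F m" using z by (simp add: F_def)
      qed
    qed
  qed
  then show ?thesis by (simp add: AE_all_countable)
qed

text \<open>Each such layer adds at least \<open>1\<close> to the jump time, wherever the chain is;
  in an absorbing state the sojourn is infinite anyway.\<close>

lemma noise_path_no_explosion: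
  assumes z: "z \<in> space (noise S R)" "s \<in> S" and r: "\<forall>N. \<exists>n\<ge>N. \<forall>x\<in>S. 1 < snd (z n x)"
  shows "\<exists>n. ereal t < jump_time (noise_path S R s z) n"
proof -
  let ?w = "noise_path S R s z"
  have w: "?w \<in> paths S R" by (rule noise_path_in_paths[OF z])
  have ge: "\<exists>n. ereal (real k) \<le> jump_time ?w n" for k
  proof (induction k)
    case 0
    have "ereal (real 0) \<le> jump_time ?w 0" by (simp add: jump_time_0)
    then show ?case ..
  next
    case (Suc k)
    then obtain n where n: "ereal (real k) \<le> jump_time ?w n" ..
    obtain n' where n': "n \<le> n'" "\<forall>x\<in>S. 1 < snd (z n' x)" using r by blast
    have "1 \<le> snd (?w n')"
      using n'(2) chain_in[OF z, of n'] by (auto simp: noise_path_def less_imp_le)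
    moreover have "ereal (real k) \<le> jump_time ?w n'"
      using n path_jump_time_mono[OF w n'(1)] by (rule order_trans)
    ultimately have "ereal (real k) + 1 \<le> jump_time ?w (Suc n')"
      unfolding jump_time_Suc by (intro add_mono)
    moreover have "ereal (real k) + 1 = ereal (real (Suc k))" by (simp add: one_ereal_def)
    ultimately have "ereal (real (Suc k)) \<le> jump_time ?w (Suc n')" by (simp only:)
    then show ?case ..
  qed
  obtain k where k: "t < real k" using reals_Archimedean2 by blast
  from ge[of k] obtain n where "ereal (real k) \<le> jump_time ?w n" ..
  moreover have "ereal t < ereal (real k)" using k by simp
  ultimately show ?thesis using less_le_trans by blast
qed

section \<open>Satisfaction is preserved by the lifting\<close>

text \<open>\<open>scheduled ts K j t\<close>: the witness \<open>ts\<close> of satisfaction requires the label with (0-based) index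
  \<open>j\<close> at time \<open>t\<close>.\<close>

definition scheduled :: "(nat \<Rightarrow> real) \<Rightarrow> nat \<Rightarrow> nat \<Rightarrow> real \<Rightarrow> bool" where
  "scheduled ts K j t \<longleftrightarrow> (if j < K then ts j \<le> t \<and> t < ts (Suc j) else j = K \<and> t = ts K)"

text \<open>Separates the timing constraints, which do not mention the path, from the label demands,
  so that paths and lifts can be compared one pair \<open>j\<close>, \<open>t\<close> at a
  time.\<close>

lemma sat_at_iff_scheduled:
  assumes "length fs = Suc K"
  shows "sat_at L fs Is \<omega> ts \<longleftrightarrow> (ts 0 = 0 \<and> (\<forall>i<K. ts i \<le> ts (Suc i) \<and> ts (Suc i) \<in> Is ! i)) \<and>
    (\<forall>j t. scheduled ts K j t \<longrightarrow> fs ! j \<in> L (at_time \<omega> t))" (is "?l \<longleftrightarrow> ?r")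
proof
  assume l: ?l
  have st: "ts i \<le> ts (Suc i)" "ts (Suc i) \<in> Is ! i"
    "\<And>t'. ts i \<le> t' \<Longrightarrow> t' < ts (Suc i) \<Longrightarrow> fs ! i \<in> L (at_time \<omega> t')" if "i < K" for i
    using l assms that unfolding sat_at_def by (auto dest!: spec[of _ "Suc i"])
  have "fs ! j \<in> L (at_time \<omega> t)" if "scheduled ts K j t" for j t
    using that st(3)[of j t] l assms by (auto simp: scheduled_def sat_at_def split: if_splits)
  then show ?r using l st by (auto simp: sat_at_def)
next
  assume r: ?r
  show ?l
    unfolding sat_at_def
  proof (intro conjI allI impI; (elim conjE)?)
    show "ts 0 = 0" using r by blast
    have "scheduled ts K K (ts K)" by (simp add: scheduled_def)
    then show "fs ! (length fs - 1) \<in> L (at_time \<omega> (ts (length fs - 1)))" using r assms by simp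
  next
    fix i assume "0 < i" "i < length fs"
    then have i: "i - 1 < K" "Suc (i - 1) = i" using assms by auto
    then show "ts (i - 1) \<le> ts i" "ts i \<in> Is ! (i - 1)" using r by metis+
    show "fs ! (i - 1) \<in> L (at_time \<omega> t')" if "ts (i - 1) \<le> t'" "t' < ts i" for t'
    proof -
      have "scheduled ts K (i - 1) t'" using i that by (simp add: scheduled_def)
      then show ?thesis using r by blast
    qed
  qed
qed

lemma schedule_mono:
  assumes "\<And>i. i < K \<Longrightarrow> ts i \<le> ts (Suc i)" "i \<le> j" "j \<le> K"
  shows "(ts i :: real) \<le> ts j"
  using assms(2,3)
proof (induction j rule: dec_induct)
  case (step n)
  then show ?case using assms(1)[of n] by simp
qed simp

lemma scheduled_bounds:
  assumes ts: "ts 0 = 0" "\<And>i. i < K \<Longrightarrow> ts i \<le> ts (Suc i)" and j: "scheduled ts K j t"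
  shows "j \<le> K" "ts j \<le> t" "0 \<le> t" "t \<le> ts K"
proof -
  show "j \<le> K" "ts j \<le> t" using j by (auto simp: scheduled_def split: if_splits)
  then show "0 \<le> t" using schedule_mono[of K ts 0 j] ts by simp
  show "t \<le> ts K" using j schedule_mono[of K ts "Suc j" K] ts(2) by (auto simp: scheduled_def split: if_splits)
qed

lemma scheduled_ex:
  assumes ts: "ts 0 = 0" and t: "0 \<le> t" "t < ts K"
  obtains j where "j < K" "scheduled ts K j t"
proof -
  define i where "i = (LEAST i. t < ts i)"
  \<comment> \<open>The least index whose time lies beyond \<open>t\<close>; it is positive because
    \<open>ts 0 = 0\<close>, and its predecessor is the scheduled label.\<close>
  have i: "t < ts i" unfolding i_def using t(2) by (rule LeastI)
  have iK: "i \<le> K" unfolding i_def using t(2) by (rule Least_le)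
  obtain j where j: "i = Suc j" using i ts t(1) by (cases i) auto
  have "\<not> t < ts j" using not_less_Least[of j "\<lambda>i. t < ts i"] j unfolding i_def by simp
  then show ?thesis using that[of j] i iK j by (simp add: scheduled_def)
qed

lemma scheduled_mono:
  assumes ts: "\<And>i. i < K \<Longrightarrow> ts i \<le> ts (Suc i)" "ts 0 = 0"
    and "scheduled ts K j t" "scheduled ts K j' t'" "t \<le> t'"
  shows "j \<le> j'"
proof (rule ccontr)
  assume "\<not> j \<le> j'"
  then have lt: "j' < j" by simp
  note b = scheduled_bounds[OF ts(2,1) assms(3)]
  have "j' < K" using lt b(1) by simp
  then have "t' < ts (Suc j')" using assms(4) by (simp add: scheduled_def)
  also have "\<dots> \<le> ts j" by (rule schedule_mono[of K ts, OF ts(1)]) (use lt b(1) in simp_all)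
  also have "\<dots> \<le> t" by (rule b(2))
  finally show False using assms(5) by simp
qed

lemma jump_index_obtain:
  assumes "\<exists>n. ereal t < jump_time \<omega> n" "0 \<le> t"
  obtains n where "jump_time \<omega> n \<le> ereal t" "ereal t < jump_time \<omega> (Suc n)"
proof -
  obtain m where m: "ereal t < jump_time \<omega> m" using assms(1) ..
  have "m \<noteq> 0" using m assms(2) by (intro notI) (simp add: jump_time_0)
  then obtain k where "m = Suc k" by (cases m) auto
  with m obtain n where "n = 0 \<or> jump_time \<omega> n \<le> ereal t" "ereal t < jump_time \<omega> (Suc n)"
    using jump_index_ex[of t \<omega> k] by metis
  then show ?thesis using that[of n] assms(2) by (auto simp: jump_time_0)
qed

lemma jump_time_real:
  assumes w: "\<omega> \<in> paths S R" and "jump_time \<omega> n \<le> ereal t"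
  obtains t0 where "jump_time \<omega> n = ereal t0" "0 \<le> t0" "t0 \<le> t"
proof -
  have "0 \<le> jump_time \<omega> n" using path_jump_time_mono[OF w, of 0 n] by (simp add: jump_time_0)
  then show ?thesis using assms(2) that by (cases "jump_time \<omega> n") auto
qed

lemma jump_time_less_Suc:
  assumes w: "\<omega> \<in> paths S R" and "jump_time \<omega> n = ereal t"
  shows "ereal t < jump_time \<omega> (Suc n)"
  unfolding jump_time_Suc assms(2) using path_time_pos[OF w, of n]
  by (cases "snd (\<omega> n)") auto

lemma jump_time_le_lift: "jump_time \<omega> n \<le> jump_time (lift L fs \<omega>) n"
  unfolding jump_time_def by (intro sum_mono) (simp add: lift_def)

context product_ctmc
begin

text \<open>The automaton never overtakes the schedule: if its state is \<open>q\<close> and the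
  label \<open>j\<close> with \<open>q \<le> j\<close> holds in the next state, the least choice
  made by \<open>delta\<close> is at most \<open>j\<close>. The demand is inspected at the moment
  each sojourn begins.\<close>

lemma run_follows_schedule:
  assumes w: "\<omega> \<in> paths S R" "fst (\<omega> 0) = s" and K: "length fs = Suc K"
    and ts: "ts 0 = 0" "\<And>i. i < K \<Longrightarrow> ts i \<le> ts (Suc i)"
    and lab: "\<And>j t. scheduled ts K j t \<Longrightarrow> fs ! j \<in> L (at_time \<omega> t)"
    and "scheduled ts K j t" "jump_time \<omega> n \<le> ereal t" "ereal t < jump_time \<omega> (Suc n)"
  shows "(\<forall>m<n. active L fs (run L fs \<omega> m)) \<and> (\<exists>q\<le>j. snd (run L fs \<omega> n) = Some q)"
  using assms(7-)
proof (induction n arbitrary: j t)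
  case 0
  have "at_time \<omega> t = fst (\<omega> 0)" using 0 by (intro at_time_eqI[OF w(1)]) auto
  then have f: "fs ! j \<in> L (fst (\<omega> 0))" using lab[OF 0(1)] by simp
  have j: "j < length fs" using scheduled_bounds(1)[OF ts 0(1)] K by simp
  have "0 < length fs - 1" using fs2 by simp
  then show ?case
    by (cases rule: delta_Some_cases[of 0 fs "L (fst (\<omega> 0))"]) (use f j in auto)
next
  case (Suc n)
  have le: "jump_time \<omega> n \<le> ereal t"
    using path_jump_time_mono[OF w(1), of n "Suc n"] Suc.prems(2) by (auto intro: order_trans)
  obtain t0 where t0: "jump_time \<omega> n = ereal t0" "0 \<le> t0" "t0 \<le> t"
    using jump_time_real[OF w(1) le] by metis
  have lt: "ereal t0 < jump_time \<omega> (Suc n)" by (rule jump_time_less_Suc[OF w(1) t0(1)])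
  then have "ereal t0 < ereal t" using Suc.prems(2) by (rule less_le_trans)
  then have tt: "t0 < t" by simp
  \<comment> \<open>The sojourn entered at \<open>t0\<close> ends before the witness does, so the
    label due at \<open>t0\<close> is not the last one and keeps the state active.\<close>
  have "t0 < ts K" using tt scheduled_bounds(4)[OF ts Suc.prems(1)] by simp
  then obtain j0 where j0: "j0 < K" "scheduled ts K j0 t0" using scheduled_ex[of ts t0 K, OF ts(1) t0(2)] by metis
  have t0': "jump_time \<omega> n \<le> ereal t0" using t0(1) by simp
  from Suc.IH[OF j0(2) t0' lt] obtain q where
    act: "\<forall>m<n. active L fs (run L fs \<omega> m)" and q: "q \<le> j0" "snd (run L fs \<omega> n) = Some q" by blast
  have fr: "fst (run L fs \<omega> n) = fst (\<omega> n)" using act by (intro fst_run) blast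
  have "at_time \<omega> t0 = fst (\<omega> n)" using t0' lt by (intro at_time_eqI[OF w(1)]) auto
  then have "fs ! j0 \<in> L (fst (run L fs \<omega> n))" using lab[OF j0(2)] fr by simp
  then have an: "active L fs (run L fs \<omega> n)"
    using q j0(1) K by (auto simp: active_def)
  have "at_time \<omega> t = fst (\<omega> (Suc n))" using Suc.prems(2,3) by (intro at_time_eqI[OF w(1)]) auto
  then have f: "fs ! j \<in> L (fst (\<omega> (Suc n)))" using lab[OF Suc.prems(1)] by simp
  have j: "j < length fs" using scheduled_bounds(1)[OF ts Suc.prems(1)] K by simp
  have qj: "q \<le> j" using q(1) scheduled_mono[OF ts(2,1) j0(2) Suc.prems(1) t0(3)] by simp
  have qK: "q < length fs - 1" using q(1) j0(1) K by simp
  have "\<exists>q'\<le>j. delta fs (Some q) (L (fst (\<omega> (Suc n)))) = Some q'"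
    by (cases rule: delta_Some_cases[OF qK, of "L (fst (\<omega> (Suc n)))"]) (use f j qj in auto)
  then have "\<exists>q'\<le>j. snd (run L fs \<omega> (Suc n)) = Some q'" using an q(2) by simp
  moreover have "\<forall>m<Suc n. active L fs (run L fs \<omega> m)" using act an by (auto simp: less_Suc_eq)
  ultimately show ?case by blast
qed

text \<open>For each scheduled pair, the sojourn containing \<open>t\<close> is located on the side
  whose labels are known. Absence of explosion provides it, and jump times agree up to the stop, so
  the other side is in the matching state.\<close>

lemma sat_at_lift:
  assumes w: "\<omega> \<in> paths S R" "fst (\<omega> 0) = s" and d: "distinct fs"
    and ne: "\<And>t. \<exists>n. ereal t < jump_time \<omega> n"
  shows "sat_at (prod_L L fs) fs Is (lift L fs \<omega>) ts \<longleftrightarrow> sat_at L fs Is \<omega> ts"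
proof -
  obtain K where K: "length fs = Suc K" using fs2 by (cases "length fs") auto
  have w': "lift L fs \<omega> \<in> paths S' R'" by (rule lift_in_paths[OF w])
  have coh: "coherent L fs (run L fs \<omega> n)" for n using run_invariant[OF w] by blast
  have fl: "fst (lift L fs \<omega> n) = run L fs \<omega> n" for n by (simp add: lift_def)
  have "(\<forall>j t. scheduled ts K j t \<longrightarrow> fs ! j \<in> prod_L L fs (at_time (lift L fs \<omega>) t)) \<longleftrightarrow>
      (\<forall>j t. scheduled ts K j t \<longrightarrow> fs ! j \<in> L (at_time \<omega> t))" (is "?l \<longleftrightarrow> ?r")
    if ts: "ts 0 = 0" "\<And>i. i < K \<Longrightarrow> ts i \<le> ts (Suc i)"
  proof
    assume r: ?r
    show ?l
    proof (intro allI impI)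
      fix j t assume j: "scheduled ts K j t"
      note b = scheduled_bounds[OF ts j]
      obtain n where n: "jump_time \<omega> n \<le> ereal t" "ereal t < jump_time \<omega> (Suc n)"
        using jump_index_obtain[OF ne b(3)] by metis
      have "(\<forall>m<n. active L fs (run L fs \<omega> m)) \<and> (\<exists>q\<le>j. snd (run L fs \<omega> n) = Some q)"
        using run_follows_schedule[OF w K ts _ j n] r by blast
      then obtain q where act: "\<And>m. m < n \<Longrightarrow> active L fs (run L fs \<omega> m)"
        and q: "q \<le> j" "snd (run L fs \<omega> n) = Some q" by blast
      have "at_time \<omega> t = fst (\<omega> n)" using n by (intro at_time_eqI[OF w(1)]) auto
      moreover have "fst (run L fs \<omega> n) = fst (\<omega> n)" by (rule fst_run[OF act])
      ultimately have f: "fs ! j \<in> L (fst (run L fs \<omega> n))" using r j by metis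
      have "at_time (lift L fs \<omega>) t = run L fs \<omega> n"
        unfolding fl[symmetric]
      proof (rule at_time_eqI[OF w'])
        show "n = 0 \<or> jump_time (lift L fs \<omega>) n \<le> ereal t" using jump_time_lift[OF act] n(1) by simp
        show "ereal t < jump_time (lift L fs \<omega>) (Suc n)"
          using n(2) jump_time_le_lift by (rule less_le_trans)
      qed
      then show "fs ! j \<in> prod_L L fs (at_time (lift L fs \<omega>) t)"
        using prod_L_iff[OF d _ coh, of j n] b(1) K q f by auto
    qed
  next
    assume l: ?l
    show ?r
    proof (intro allI impI)
      fix j t assume j: "scheduled ts K j t"
      note b = scheduled_bounds[OF ts j]
      have "\<exists>n. ereal t < jump_time (lift L fs \<omega>) n"
        using ne[of t] jump_time_le_lift less_le_trans by blast
      then obtain n where n: "jump_time (lift L fs \<omega>) n \<le> ereal t" "ereal t < jump_time (lift L fs \<omega>) (Suc n)"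
        using jump_index_obtain[OF _ b(3)] by metis
      \<comment> \<open>Stopping at an earlier index would make jump time \<open>n\<close> of the
        lift infinite, contrary to its being at most \<open>t\<close>.\<close>
      have act: "active L fs (run L fs \<omega> m)" if "m < n" for m
      proof (rule ccontr)
        assume "\<not> active L fs (run L fs \<omega> m)"
        then have "snd (lift L fs \<omega> m) = \<infinity>" by (simp add: lift_def)
        moreover have "0 \<le> jump_time (lift L fs \<omega>) m"
          using path_jump_time_mono[OF w', of 0 m] by (simp add: jump_time_0)
        ultimately have "jump_time (lift L fs \<omega>) (Suc m) = \<infinity>" by (simp add: jump_time_Suc)
        moreover have "jump_time (lift L fs \<omega>) (Suc m) \<le> ereal t"
          using path_jump_time_mono[OF w', of "Suc m" n] that n(1) by (auto intro: order_trans)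
        ultimately show False by simp
      qed
      have jn: "jump_time (lift L fs \<omega>) n = jump_time \<omega> n" by (rule jump_time_lift[OF act])
      have at': "at_time (lift L fs \<omega>) u = run L fs \<omega> n" if "jump_time \<omega> n \<le> ereal u" "u \<le> t" for u
        unfolding fl[symmetric]
      proof (rule at_time_eqI[OF w'])
        show "n = 0 \<or> jump_time (lift L fs \<omega>) n \<le> ereal u" using jn that(1) by simp
        have "ereal u \<le> ereal t" using that(2) by simp
        then show "ereal u < jump_time (lift L fs \<omega>) (Suc n)" using n(2) by (rule le_less_trans)
      qed
      \<comment> \<open>Stated for every demand within the current sojourn up to \<open>t\<close>:
        at \<open>t\<close> itself it yields the label sought, at the entry time it rules out
        stopping in \<open>q_k\<close> before the witness ends.\<close>
      have req: "\<exists>q\<le>j'. snd (run L fs \<omega> n) = Some q \<and> fs ! j' \<in> L (fst (\<omega> n))"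
        if "scheduled ts K j' u" "jump_time \<omega> n \<le> ereal u" "u \<le> t" for j' u
      proof -
        have "fs ! j' \<in> prod_L L fs (run L fs \<omega> n)" using l that at'[OF that(2,3)] by metis
        moreover have "fst (run L fs \<omega> n) = fst (\<omega> n)" by (rule fst_run[OF act])
        ultimately show ?thesis
          using prod_L_iff[OF d _ coh, of j' n] scheduled_bounds(1)[OF ts that(1)] K by simp
      qed
      have le: "jump_time \<omega> n \<le> ereal t" using n(1) jn by simp
      obtain q where q: "q \<le> j" "snd (run L fs \<omega> n) = Some q" "fs ! j \<in> L (fst (\<omega> n))"
        using req[OF j le order_refl] by blast
      have "ereal t < jump_time \<omega> (Suc n)"
      proof (cases "active L fs (run L fs \<omega> n)")
        case True
        then have "jump_time (lift L fs \<omega>) (Suc n) = jump_time \<omega> (Suc n)"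
          using act by (intro jump_time_lift) (auto simp: less_Suc_eq)
        then show ?thesis using n(2) by simp
      next
        case False
        \<comment> \<open>The lifted path has been stopped in \<open>q\<^sub>k\<close>, where only the last label survives; hence the
          witness ends exactly at the jump into this state.\<close>
        then have qK: "\<not> q < K" using active_coherent_iff[OF coh] q(2) K by auto
        obtain t0 where t0: "jump_time \<omega> n = ereal t0" "0 \<le> t0" "t0 \<le> t"
          using jump_time_real[OF w(1) le] by metis
        have "t0 = t"
        proof (rule ccontr)
          assume "t0 \<noteq> t"
          then have "t0 < ts K" using t0(3) b(4) by simp
          then obtain j0 where j0: "j0 < K" "scheduled ts K j0 t0" using scheduled_ex[of ts t0 K, OF ts(1) t0(2)] by metis
          have "jump_time \<omega> n \<le> ereal t0" using t0(1) by simp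
          from req[OF j0(2) this t0(3)] q(2) qK j0(1) show False by auto
        qed
        then show ?thesis using jump_time_less_Suc[OF w(1) t0(1)] by simp
      qed
      then have "at_time \<omega> t = fst (\<omega> n)" using le by (intro at_time_eqI[OF w(1)]) auto
      then show "fs ! j \<in> L (at_time \<omega> t)" using q(3) by simp
    qed
  qed
  then show ?thesis
    unfolding sat_at_iff_scheduled[OF K] by blast
qed

end

text \<open>Both sides are probabilities of noise events that agree almost surely. \<open>L'\<close>
  is prescribed only on \<open>S'\<close>, since \<open>restr_L\<close> empties the labels
  elsewhere; lifted paths never leave \<open>S'\<close>.\<close>

lemma (in product_ctmc) prob_formula_product:
  assumes len: "length Is = length fs - 1" and Is: "\<And>I. I \<in> set Is \<Longrightarrow> valid_interval I"
    and d: "distinct fs" and L': "\<And>y. y \<in> S' \<Longrightarrow> L' y = prod_L L fs y"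
  shows "prob_formula S' R' L' fs Is (s, delta fs (Some 0) (L s)) = prob_formula S R L fs Is s"
proof -
  let ?Z = "noise S R" and ?G = "noise_path S R s" and ?sB = "(s, delta fs (Some 0) (L s))"
  let ?H = "\<lambda>z. lift L fs (noise_path S R s z)"
  define A where "A = {\<omega> \<in> paths S R. fst (\<omega> 0) = s \<and> sat L fs Is \<omega>}"
  define B where "B = {\<omega> \<in> paths S' R'. fst (\<omega> 0) = ?sB \<and> sat L' fs Is \<omega>}"
  interpret Z: prob_space ?Z by (rule prob_space_noise[OF C])
  have pos: "0 < length fs" using fs2 by linarith
  have Am: "A \<in> sets (path_space S R)"
    unfolding A_def by (rule sat_measurable[OF C pos len Is])
  have Bm: "B \<in> sets (path_space S' R')"
    unfolding B_def by (rule sat_measurable[OF ctmc_product pos len Is])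
  have G: "?G \<in> space ?Z \<rightarrow> paths S R" using noise_path_in_paths[OF _ s] by blast
  have PG: "?G \<in> measurable ?Z (path_space S R)"
    by (rule Pr_eq_distr(1)[OF C prob_space_noise[OF C] G emeasure_noise_path_cyl[OF C s]])
  have PG': "Pr S R (\<lambda>x. if x = s then 1 else 0) = distr ?Z (path_space S R) ?G"
    by (rule Pr_eq_distr(2)[OF C prob_space_noise[OF C] G emeasure_noise_path_cyl[OF C s]])
  have eqA: "prob_formula S R L fs Is s = measure ?Z (?G -` A \<inter> space ?Z)"
    unfolding prob_formula_def A_def[symmetric] PG' by (rule measure_distr[OF PG Am])
  have eqB: "prob_formula S' R' L' fs Is ?sB = measure ?Z (?H -` B \<inter> space ?Z)"
    unfolding prob_formula_def B_def[symmetric] Pr_product(2) by (rule measure_distr[OF Pr_product(1) Bm])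
  have "AE z in ?Z. z \<in> ?H -` B \<inter> space ?Z \<longleftrightarrow> z \<in> ?G -` A \<inter> space ?Z"
    using AE_noise_recurrent[OF C] AE_space
  proof eventually_elim
    case (elim z)
    have w: "?G z \<in> paths S R" "fst (?G z 0) = s"
      using noise_path_in_paths[OF elim(2) s] noise_path_start by auto
    have w': "?H z \<in> paths S' R'" by (rule lift_in_paths[OF w])
    have start': "fst (?H z 0) = ?sB" using w(2) by (simp add: lift_def)
    have "at_time (?H z) t \<in> S'" for t
      using w' unfolding at_time_def paths_def by blast
    then have "L' (at_time (?H z) t) = prod_L L fs (at_time (?H z) t)" for t by (rule L')
    then have "sat_at L' fs Is (?H z) ts \<longleftrightarrow> sat_at (prod_L L fs) fs Is (?H z) ts" for ts
      unfolding sat_at_def by (simp only:)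
    then have "sat_at L' fs Is (?H z) ts \<longleftrightarrow> sat_at L fs Is (?G z) ts" for ts
      using sat_at_lift[OF w d noise_path_no_explosion[OF elim(2) s elim(1)]] by (simp only:)
    then have "sat L' fs Is (?H z) \<longleftrightarrow> sat L fs Is (?G z)"
      unfolding sat_iff_sat_at by (intro iff_exI)
    then show ?case
      using w w' start' unfolding A_def B_def by blast
  qed
  then show ?thesis
    unfolding eqA eqB
    by (rule Z.finite_measure_eq_AE) (use measurable_sets[OF PG Am] measurable_sets[OF Pr_product(1) Bm] in auto)
qed

section \<open>The product and its reachable part\<close>

lemma coherent_aut_states: "coherent L fs y \<Longrightarrow> snd y \<in> aut_states fs"
  by (cases "snd y") (auto simp: coherent_def aut_states_def)

lemma prod_R_nonzeroD:
  assumes C: "ctmc S R" and "prod_R R L fs y y' \<noteq> 0"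
  shows "y \<in> prod_S S fs" "y' \<in> prod_S S fs" "coherent L fs y'"
proof -
  have nz: "active L fs y" "snd y' = delta fs (snd y) (L (fst y'))" "R (fst y) (fst y') \<noteq> 0"
    using assms(2) by (auto simp: prod_R_eq split: if_splits)
  then obtain i where i: "snd y = Some i" "i < length fs - 1" by (auto elim: active_obtain)
  have S: "fst y \<in> S" "fst y' \<in> S" using C nz(3) unfolding ctmc_def by blast+
  show coh: "coherent L fs y'"
    using coherent_delta[OF i(2), of L "fst y'"] nz(2) i(1) by (metis prod.collapse)
  show "y \<in> prod_S S fs"
    using S i by (cases y) (auto simp: prod_S_def aut_states_def)
  show "y' \<in> prod_S S fs"
    using S coherent_aut_states[OF coh] by (cases y') (auto simp: prod_S_def)
qed

lemma reach_prod_R: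
  assumes C: "ctmc S R" and "2 \<le> length fs" "s \<in> S"
    and y: "y \<in> reach (prod_R R L fs) (s, delta fs (Some 0) (L s))"
  shows "coherent L fs y \<and> y \<in> prod_S S fs"
  using y unfolding reach_def mem_Collect_eq
proof (induction rule: rtrancl_induct)
  case base
  have "coherent L fs (s, delta fs (Some 0) (L s))" using assms(2) by (intro coherent_delta) simp
  then show ?case using coherent_aut_states[of L fs "(s, delta fs (Some 0) (L s))"] assms(3) by (simp add: prod_S_def)
next
  case (step y y')
  then show ?case using prod_R_nonzeroD[OF C, of L fs y y'] by simp
qed

text \<open>Label \<open>i\<close> holds by coherence and \<open>prod_L\<close> has removed
  everything below it, so the stratification order is just the order of automaton states.\<close>

lemma fmin_coherent:
  assumes d: "distinct fs" and coh: "coherent L fs y" and L': "L' y = prod_L L fs y"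
  shows "fmin L' fs y = snd y"
proof (cases "snd y")
  case None
  then have "\<not> (\<exists>i<length fs. fs ! i \<in> L' y)" using prod_L_iff[OF d _ coh] L' by auto
  then show ?thesis using None by (simp add: fmin_def)
next
  case (Some i)
  then have i: "i < length fs" "fs ! i \<in> L (fst y)" using coh by (auto simp: coherent_def)
  have iff: "fs ! j \<in> L' y \<longleftrightarrow> i \<le> j \<and> fs ! j \<in> L (fst y)" if "j < length fs" for j
    using prod_L_iff[OF d that coh] L' Some by auto
  have "(LEAST j. j < length fs \<and> fs ! j \<in> L' y) = i"
    using i iff by (intro Least_equality) auto
  moreover have "\<exists>i<length fs. fs ! i \<in> L' y" using i iff by auto
  ultimately show ?thesis using Some by (simp add: fmin_def)
qed

theorem theorem1:
  fixes S :: "'s set" and R :: "'s \<Rightarrow> 's \<Rightarrow> real" and L :: "'s \<Rightarrow> 'a set"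
    and fs :: "'a list" and Is :: "real set list" and s :: 's
  assumes "ctmc S R"
    and "2 \<le> length fs"
    and "length Is = length fs - 1"
    and "\<forall>I\<in>set Is. valid_interval I"
    and "distinct fs"
    and "s \<in> S"
  shows "let sB = (s, delta fs (Some 0) (L s));
             RP = prod_R R L fs; LP = prod_L L fs
         in stratified (reach RP sB) (restr_R RP sB) (restr_L RP LP sB) fs \<and>
            prob_formula S R L fs Is s =
              prob_formula (reach RP sB) (restr_R RP sB) (restr_L RP LP sB) fs Is sB \<and>
            prob_formula (reach RP sB) (restr_R RP sB) (restr_L RP LP sB) fs Is sB =
              prob_formula (prod_S S fs) RP LP fs Is sB"
proof -
  let ?sB = "(s, delta fs (Some 0) (L s))" and ?RP = "prod_R R L fs" and ?LP = "prod_L L fs"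
  let ?Q = "reach ?RP ?sB" and ?RQ = "restr_R ?RP ?sB" and ?LQ = "restr_L ?RP ?LP ?sB"
  have Is: "\<And>I. I \<in> set Is \<Longrightarrow> valid_interval I" using assms(4) by blast
  note reach = reach_prod_R[OF assms(1,2,6)]
  have start: "?sB \<in> ?Q" by (simp add: reach_def)
  have LQ: "?LQ y = ?LP y" if "y \<in> ?Q" for y using that by (simp add: restr_L_def)
  \<comment> \<open>The reachable part and the full product are each compared with the original
    CTMC; their mutual equality follows from these two comparisons.\<close>
  interpret Q: product_ctmc S R L fs s ?Q ?RQ
  proof
    show "y' \<in> ?Q" if "y \<in> ?Q" "0 < ?RP y y'" for y y'
      using that by (auto simp: reach_def intro: rtrancl_into_rtrancl)
  qed (use assms start reach in \<open>auto simp: restr_R_def\<close>)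
  interpret P: product_ctmc S R L fs s "prod_S S fs" ?RP
  proof
    show "y' \<in> prod_S S fs" if "0 < ?RP y y'" for y y'
      using prod_R_nonzeroD(2)[OF assms(1), of L fs y y'] that by simp
    show "?RP y y' = (if y \<in> prod_S S fs \<and> y' \<in> prod_S S fs then ?RP y y' else 0)" for y y'
      using prod_R_nonzeroD(1,2)[OF assms(1), of L fs y y'] by auto
  qed (use assms reach[OF start] in auto)
  have "stratified ?Q ?RQ ?LQ fs"
    unfolding stratified_def
  proof (intro ballI)
    fix y y' assume y: "y \<in> ?Q" and y': "y' \<in> ?Q"
    have coh: "coherent L fs y" "coherent L fs y'" using reach y y' by blast+
    have f: "fmin ?LQ fs y = snd y" "fmin ?LQ fs y' = snd y'"
      by (rule fmin_coherent[OF assms(5) coh(1)], rule LQ[OF y])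
         (rule fmin_coherent[OF assms(5) coh(2)], rule LQ[OF y'])
    have "?RQ y y' = 0" if "snd y = None \<or> snd y = Some (length fs - 1)"
    proof -
      have "\<not> active L fs y" using active_coherent_iff[OF coh(1)] that by auto
      then show ?thesis by (simp add: restr_R_def prod_R_eq)
    qed
    \<comment> \<open>\<open>delta\<close> searches upwards from the current index, so automaton
      states never decrease along transitions.\<close>
    moreover have "the (snd y) \<le> the (snd y')" if "0 < ?RQ y y'" "snd y' \<noteq> None"
    proof -
      have "active L fs y" "snd y' = delta fs (snd y) (L (fst y'))"
        using Q.R'_pos_iff(1)[OF y, of y'] that(1) by auto
      moreover from this(1) obtain i where i: "snd y = Some i" "i < length fs - 1" by (rule active_obtain)
      ultimately show ?thesis
        using that(2) by (cases rule: delta_Some_cases[OF i(2), of "L (fst y')"]) auto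
    qed
    ultimately show "if fmin ?LQ fs y = None \<or> fmin ?LQ fs y = Some (length fs - 1) then ?RQ y y' = 0
      else 0 < ?RQ y y' \<and> fmin ?LQ fs y' \<noteq> None \<longrightarrow> the (fmin ?LQ fs y) \<le> the (fmin ?LQ fs y')"
      unfolding f by auto
  qed
  moreover have "prob_formula ?Q ?RQ ?LQ fs Is ?sB = prob_formula S R L fs Is s"
    by (rule Q.prob_formula_product[OF assms(3) Is assms(5) LQ])
  moreover have "prob_formula (prod_S S fs) ?RP ?LP fs Is ?sB = prob_formula S R L fs Is s"
    by (rule P.prob_formula_product[OF assms(3) Is assms(5) refl])
  ultimately show ?thesis unfolding Let_def by simp
qed

end
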